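(* Assume that $\mu \colon \mathcal{P}^2_o \to \mathbb{R}^2$ is a measurable valuation which is $\mathrm{VL}(2)$-signum-covariant, i.e. $\mu(\phi P) = (\det\phi)\,\phi\,\mu(P)$ for all $P \in \mathcal{P}^2_o$ and all $\phi \in \mathrm{VL}(2)$. Then there exists $k \in \mathbb{R}$ such that $\mu(P) = k\,\rho_{\frac{\pi}{2}}\, m(P^* )$ for all $P \in \mathcal{P}^2_o$.
   Context: $\mathcal{P}^2_o$ denotes the set of convex polygons in $\mathbb{R}^2$ containing the origin in their interiors, with the Hausdorff metric topology; "measurable" refers to Borel $\sigma$-algebras. $\mathrm{VL}(2)$ is the group of linear maps of $\mathbb{R}^2$ with determinant $1$ or $-1$. A map $\mu$ on a family $\mathcal{S}$ of sets is a valuation if $\mu(K \cup L) + \mu(K \cap L) = \mu(K) + \mu(L)$ whenever $K, L, K\cup L, K \cap L \in \mathcal{S}$. The moment vector is $m(P) = \int_P x\,dx$; $P^* = \{y : y^t x \le 1 \ \forall x \in P\}$ is the polar body; $\rho_{\frac{\pi}{2}}$ is the counter-clockwise rotation of $\mathbb{R}^2$ by $\frac{\pi}{2}$. *)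

theory Defs
  imports "HOL-Analysis.Analysis"
begin

type_synonym R2 = "real^2"

definition polygons_o :: "R2 set set" where
  "polygons_o = {P. \<exists>S. finite S \<and> P = convex hull S \<and> 0 \<in> interior P}"

definition hausdorff_dist :: "R2 set \<Rightarrow> R2 set \<Rightarrow> real" where
  "hausdorff_dist K L =
     max (SUP x\<in>K. setdist {x} L) (SUP y\<in>L. setdist {y} K)"

definition hausdorff_open :: "R2 set set \<Rightarrow> bool" where
  "hausdorff_open U \<longleftrightarrow> U \<subseteq> polygons_o \<and>
     (\<forall>P\<in>U. \<exists>e>0. \<forall>Q\<in>polygons_o. hausdorff_dist P Q < e \<longrightarrow> Q \<in> U)"

definition polygons_borel :: "R2 set measure" where
  "polygons_borel = sigma polygons_o {U. hausdorff_open U}"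

definition is_valuation_on :: "'a set set \<Rightarrow> ('a set \<Rightarrow> 'b::ab_group_add) \<Rightarrow> bool" where
  "is_valuation_on S mu \<longleftrightarrow>
     (\<forall>K L. K \<in> S \<and> L \<in> S \<and> K \<union> L \<in> S \<and> K \<inter> L \<in> S \<longrightarrow>
        mu (K \<union> L) + mu (K \<inter> L) = mu K + mu L)"

definition VL2 :: "(real^2^2) set" where
  "VL2 = {A. det A = 1 \<or> det A = -1}"

definition moment :: "R2 set \<Rightarrow> R2" where
  "moment P = integral P (\<lambda>x. x)"

definition polar :: "R2 set \<Rightarrow> R2 set" where
  "polar P = {y. \<forall>x\<in>P. y \<bullet> x \<le> 1}"

definition rot90 :: "R2 \<Rightarrow> R2" where
  "rot90 x = vector [- (x$2), x$1]"

end

theory Submission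
  imports Defs
begin

text \<open>
  Passing to the polar body, \<open>\<nu>(P) = \<rho>\<^sup>-\<^sup>1 \<mu>(P\<^sup>*)\<close> is a valuation with
  \<open>\<nu>(\<phi> P) = \<phi> \<nu>(P)\<close>, so it remains to show that \<open>\<nu>\<close> is a multiple of the moment vector.

  Consider a quadrilateral with the origin on the diagonal \<open>[(-a,0), (b,0)]\<close>. For fixed \<open>a, b\<close> the
  valuation property makes \<open>\<nu>\<close> a sum of a function of the upper and one of the lower vertex. How
  the upper summand changes under shears is an additive function, and measurability makes it
  linear with some slope \<open>q(a, b, t)\<close>, where \<open>t\<close> is the height of the upper vertex. The
  remaining symmetries express \<open>\<nu>\<close> of the quadrilateral through \<open>q\<close>. A triangle is a degenerate
  quadrilateral in several ways, which gives a functional equation for \<open>q\<close> with the solutions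
  \<open>q(a, b, t) = C t\<^sup>2 (a + b)\<close> only. Hence \<open>\<nu>\<close> is determined on these quadrilaterals by the
  constant \<open>C\<close>. The moment vector has a nonzero constant, so \<open>\<nu> - k m\<close> vanishes on them
  for some \<open>k\<close>.

  A valuation that vanishes on all linear images of these quadrilaterals vanishes everywhere: unless
  \<open>P\<close> is one of them, it has a vertex \<open>c\<close> for which the origin stays in the interior of the hull
  \<open>A\<close> of the other vertices. With the edge \<open>[x, y]\<close> of \<open>A\<close> facing \<open>c\<close> and a small multiple \<open>w\<close>
  of \<open>-c\<close>, the quadrilateral \<open>B = [c, x, w, y]\<close> satisfies \<open>A \<union> B = P\<close> and \<open>A \<inter> B = [x, w, y]\<close>.
\<close>

section \<open>Additive functions\<close>

lemma nonnegligible_contains_compact: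
  fixes A :: "'a::euclidean_space set"
  assumes "A \<in> sets lebesgue" "\<not> negligible A"
  obtains K where "compact K" "K \<subseteq> A" "\<not> negligible K"
proof -
  have "A = (\<Union>n. A \<inter> cball 0 (real n))"
    using real_arch_simple by fastforce
  then obtain n where nonnegligible: "\<not> negligible (A \<inter> cball 0 (real n))"
    using assms(2) negligible_Union_nat[of "\<lambda>n. A \<inter> cball 0 (real n)"] by auto
  let ?B = "A \<inter> cball 0 (real n)"
  have lmeasurable: "?B \<in> lmeasurable"
    using assms(1) by (intro bounded_set_imp_lmeasurable) auto
  then have "measure lebesgue ?B > 0"
    using nonnegligible by (simp add: negligible_iff_measure zero_less_measure_iff)
  then obtain K where inner: "closed K" "K \<subseteq> ?B" "?B - K \<in> lmeasurable"
      "emeasure lebesgue (?B - K) < ennreal (measure lebesgue ?B)"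
    using sets_lebesgue_inner_closed[of ?B] lmeasurable by (metis fmeasurableD)
  show thesis
  proof
    show "compact K"
      using inner(1,2) by (meson bounded_cball bounded_subset compact_eq_bounded_closed le_inf_iff)
    show "K \<subseteq> A" using inner(2) by blast
    show "\<not> negligible K"
    proof
      assume "negligible K"
      then have "measure lebesgue (?B - K) = measure lebesgue ?B"
        by (simp add: measure_Diff_null_set lmeasurable fmeasurableD negligible_iff_null_sets)
      then show False
        using inner(3,4) by (simp add: emeasure_eq_measure2)
    qed
  qed
qed

lemma steinhaus:
  fixes A :: "'a::euclidean_space set"
  assumes "A \<in> sets lebesgue" "\<not> negligible A"
  obtains d where "d > 0" "\<And>t. norm t < d \<Longrightarrow> \<exists>x\<in>A. x + t \<in> A"
proof -
  obtain K where compact_K: "compact K" "K \<subseteq> A" "\<not> negligible K"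
    using nonnegligible_contains_compact[OF assms] by blast
  then have K_measure: "K \<in> lmeasurable" "measure lebesgue K > 0"
    by (auto simp: lmeasurable_compact negligible_iff_measure zero_less_measure_iff)
  obtain U where outer: "open U" "K \<subseteq> U" "U - K \<in> lmeasurable"
      "emeasure lebesgue (U - K) < ennreal (measure lebesgue K)"
    using sets_lebesgue_outer_open[OF fmeasurableD[OF K_measure(1)] K_measure(2)] by blast
  have small: "measure lebesgue (U - K) < measure lebesgue K"
    using outer(3,4) K_measure(2) by (simp add: emeasure_eq_measure2 ennreal_less_iff)
  obtain d where "d > 0" and separated: "\<And>x y. x \<in> K \<Longrightarrow> y \<in> - U \<Longrightarrow> d \<le> dist x y"
    using separate_compact_closed[OF compact_K(1) closed_Compl[OF outer(1)]] outer(2) by blast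
  show thesis
  proof
    show "d > 0" by fact
    fix t :: 'a assume t_small: "norm t < d"
    have "(+) t ` K \<subseteq> U"
    proof (rule image_subsetI, rule ccontr)
      fix x assume "x \<in> K" "t + x \<notin> U"
      then show False using separated[of x "t + x"] t_small by (simp add: dist_norm)
    qed
    moreover have "\<not> (+) t ` K \<subseteq> U - K"
    proof
      assume "(+) t ` K \<subseteq> U - K"
      moreover have "(+) t ` K \<in> lmeasurable"
        using K_measure(1) by (simp add: measurable_translation)
      ultimately have "measure lebesgue ((+) t ` K) \<le> measure lebesgue (U - K)"
        using outer(3) by (intro measure_mono_fmeasurable) (auto intro: fmeasurableD)
      then show False using small by (simp add: measure_translation)
    qed
    ultimately obtain x where "x \<in> K" "t + x \<in> K" by blast
    then show "\<exists>x\<in>A. x + t \<in> A" using compact_K(2) by (metis add.commute subsetD)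
  qed
qed

lemma additive_scaleR_of_nat:
  fixes f :: "'a::real_vector \<Rightarrow> 'b::real_vector"
  assumes "Modules.additive f"
  shows "f (real n *\<^sub>R x) = real n *\<^sub>R f x"
proof (induction n)
  case (Suc n)
  then show ?case
    using additive.add[OF assms, of "real n *\<^sub>R x" x] by (simp add: scaleR_add_left add.commute)
qed (simp add: additive.zero[OF assms])

lemma additive_bounded_imp_zero:
  fixes f :: "'a::real_vector \<Rightarrow> 'b::real_normed_vector"
  assumes f_additive: "Modules.additive f" and bound: "\<And>x. norm (f x) \<le> B"
  shows "f x = 0"
proof (rule ccontr)
  assume "f x \<noteq> 0"
  then obtain n where "B < real n * norm (f x)"
    using reals_Archimedean3[of "norm (f x)"] by auto
  also have "\<dots> = norm (f (real n *\<^sub>R x))"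
    by (simp add: additive_scaleR_of_nat[OF f_additive])
  finally show False using bound by (meson not_le)
qed

lemma additive_bounded_on_unit_interval_imp_scaleR:
  fixes f :: "real \<Rightarrow> 'b::real_normed_vector"
  assumes f_additive: "Modules.additive f" and bound: "\<And>u. 0 \<le> u \<Longrightarrow> u < 1 \<Longrightarrow> norm (f u) \<le> B"
  shows "f r = r *\<^sub>R f 1"
proof -
  define h where "h u = f u - u *\<^sub>R f 1" for u
  interpret additive f by (fact f_additive)
  interpret h: additive h
    by standard (simp add: h_def add scaleR_add_left)
  have "h (real n) = 0" for n
    using additive_scaleR_of_nat[OF f_additive, of n 1] by (simp add: h_def)
  then have h_int: "h (of_int k) = 0" for k
    by (cases k rule: int_cases2) (auto simp: h.minus)
  have h_bound: "norm (h u) \<le> B + norm (f 1)" for u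
  proof -
    have "h u = h (frac u)"
      using h.add[of "frac u" "of_int \<lfloor>u\<rfloor>"] h_int by (simp add: frac_def)
    then have "norm (h u) \<le> norm (f (frac u)) + norm (frac u *\<^sub>R f 1)"
      by (simp only: h_def norm_triangle_ineq4)
    moreover have "norm (f (frac u)) \<le> B" "norm (frac u *\<^sub>R f 1) \<le> norm (f 1)"
      using bound[of "frac u"] frac_lt_1[of u] by (auto simp: mult_left_le_one_le)
    ultimately show ?thesis by linarith
  qed
  have "h r = 0" using additive_bounded_imp_zero[OF h.additive_axioms h_bound] .
  then show ?thesis by (simp add: h_def)
qed

lemma additive_bounded_near_0_imp_linear:
  fixes f :: "'a::real_normed_vector \<Rightarrow> 'b::real_normed_vector"
  assumes f_additive: "Modules.additive f" and "d > 0" and bound: "\<And>x. norm x < d \<Longrightarrow> norm (f x) \<le> B"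
  shows "linear f"
proof (rule linearI)
  interpret additive f by (fact f_additive)
  show "f (x + y) = f x + f y" for x y by (rule add)
  fix r :: real and x :: 'a
  obtain n where n_large: "norm x / d < real n" using reals_Archimedean2 by blast
  then have "n > 0" using \<open>d > 0\<close> by (metis divide_nonneg_pos norm_ge_zero not_le of_nat_0 gr0I)
  have ray_bound: "norm (f (u *\<^sub>R x)) \<le> real n * B" if u_unit: "0 \<le> u" "u < 1" for u
  proof -
    have "u * norm x \<le> norm x" using u_unit by (simp add: mult_left_le_one_le)
    also have "norm x < real n * d" using n_large \<open>d > 0\<close> by (simp add: divide_less_eq)
    finally have "norm ((u / n) *\<^sub>R x) < d"
      using u_unit \<open>n > 0\<close> by (simp add: divide_less_eq mult.commute)
    moreover have "f (u *\<^sub>R x) = real n *\<^sub>R f ((u / n) *\<^sub>R x)"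
      using additive_scaleR_of_nat[OF f_additive, of n "(u / n) *\<^sub>R x"] \<open>n > 0\<close> by simp
    ultimately show ?thesis using bound[of "(u / n) *\<^sub>R x"] by (simp add: mult_left_mono)
  qed
  have "Modules.additive (\<lambda>u. f (u *\<^sub>R x))"
    by standard (simp add: scaleR_add_left add)
  from additive_bounded_on_unit_interval_imp_scaleR[OF this ray_bound]
  show "f (r *\<^sub>R x) = r *\<^sub>R f x" by simp
qed

definition bounded_on_nonnegligible ::
    "'a::euclidean_space set \<Rightarrow> ('a \<Rightarrow> 'b::real_normed_vector) \<Rightarrow> bool" where
  "bounded_on_nonnegligible S f \<longleftrightarrow>
     (\<exists>A\<in>sets lebesgue. A \<subseteq> S \<and> \<not> negligible A \<and> bounded (f ` A))"

lemma additive_bounded_on_nonnegligible_imp_linear: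
  fixes f :: "'a::euclidean_space \<Rightarrow> 'b::real_normed_vector"
  assumes f_additive: "Modules.additive f" and bounded: "bounded_on_nonnegligible S f"
  shows "linear f"
proof -
  obtain A B where A_nonnegligible: "A \<in> sets lebesgue" "\<not> negligible A"
    and bound: "\<And>x. x \<in> A \<Longrightarrow> norm (f x) \<le> B"
    using bounded by (auto simp: bounded_on_nonnegligible_def bounded_iff)
  obtain d where "d > 0" and difference: "\<And>t. norm t < d \<Longrightarrow> \<exists>x\<in>A. x + t \<in> A"
    using steinhaus[OF A_nonnegligible] by blast
  have "norm (f t) \<le> B + B" if t_small: "norm t < d" for t
  proof -
    obtain x where shift_in_A: "x \<in> A" "x + t \<in> A" using difference[OF t_small] by blast
    have "f t = f (x + t) - f x" using additive.add[OF f_additive] by simp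
    then show ?thesis
      using norm_triangle_ineq4[of "f (x + t)" "f x"] bound[OF shift_in_A(1)]
        bound[OF shift_in_A(2)] by simp
  qed
  then show ?thesis using additive_bounded_near_0_imp_linear[OF f_additive \<open>d > 0\<close>] by blast
qed

lemma borel_measurable_imp_bounded_on_nonnegligible:
  fixes f :: "'a::euclidean_space \<Rightarrow> 'b::real_normed_vector"
  assumes f_measurable: "f \<in> borel_measurable borel"
    and S_nonnegligible: "S \<in> sets borel" "\<not> negligible S"
  shows "bounded_on_nonnegligible S f"
proof -
  define A where "A n = S \<inter> {x. norm (f x) \<le> real n}" for n
  have "A n \<in> sets borel" for n unfolding A_def using f_measurable S_nonnegligible(1) by measurable
  then have "A n \<in> sets lebesgue" for n by auto
  moreover have "S = (\<Union>n. A n)" using real_arch_simple by (force simp: A_def)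
  then obtain n where "\<not> negligible (A n)"
    using S_nonnegligible(2) negligible_Union_nat[of A] by auto
  moreover have "A n \<subseteq> S" "bounded (f ` A n)" by (auto simp: A_def bounded_iff)
  ultimately show ?thesis unfolding bounded_on_nonnegligible_def by blast
qed

section \<open>A functional equation\<close>

lemma homogeneous_difference_imp_inverse_square:
  fixes W :: "real \<Rightarrow> real"
  assumes scale: "\<And>l x y. l > 0 \<Longrightarrow> x > 0 \<Longrightarrow> y > 0 \<Longrightarrow> W (l * x) - W (l * y) = (W x - W y) / l\<^sup>2"
  obtains C E where "\<And>z. z > 0 \<Longrightarrow> W z = C + E / z\<^sup>2"
proof
  fix z :: real assume z_pos: "z > 0"
  define D where "D = W 2 - W 1"
  have "W (2 * z) - W 2 = (W z - W 1) / 4" using scale[of 2 z 1] z_pos by simp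
  moreover have "W (2 * z) - W z = D / z\<^sup>2"
    using scale[of z 2 1] z_pos by (simp add: mult.commute D_def)
  ultimately have "W z = (W 1 + 4 / 3 * D) + - (4 / 3) * (D / z\<^sup>2)"
    unfolding D_def by argo
  then show "W z = (W 1 + 4 / 3 * D) + (- (4 / 3) * D) / z\<^sup>2" by simp
qed

locale triangle_equation =
  fixes q :: "real \<Rightarrow> real \<Rightarrow> real \<Rightarrow> real"
  assumes symmetric: "a > 0 \<Longrightarrow> b > 0 \<Longrightarrow> t > 0 \<Longrightarrow> q a b t = q b a t"
    and homogeneous: "l > 0 \<Longrightarrow> a > 0 \<Longrightarrow> b > 0 \<Longrightarrow> t > 0 \<Longrightarrow> q (l * a) (l * b) (t / l) = q a b t / l"
    and exchange: "a > 0 \<Longrightarrow> b > 0 \<Longrightarrow> s > 0 \<Longrightarrow> t > 0 \<Longrightarrow>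
        2 * (q s t b - q s t a) = (q t t b - q t t a) + (q s s b - q s s a)"
    and triangle: "p > 0 \<Longrightarrow> s > 0 \<Longrightarrow> t > 0 \<Longrightarrow>
        q 1 p (s / (p + 1)) - q 1 p t + s / p * q t (s / (p + 1)) p
        = q 1 (p * t / (s + t)) s - q 1 (p * t / (s + t)) t"
begin

definition profile :: "real \<Rightarrow> real" where
  "profile z = q 1 1 z / (2 * z)"

definition defect :: "real \<Rightarrow> real \<Rightarrow> real" where
  "defect a b = q a b 1 - (profile a + profile b)"

lemma diagonal:
  assumes "a > 0" "t > 0"
  shows "q a a t = 2 * t * profile (a * t)"
proof -
  have "q a a t = q (a * 1) (a * 1) ((a * t) / a)" using assms by simp
  also have "\<dots> = q 1 1 (a * t) / a" using assms by (subst homogeneous) auto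
  finally show ?thesis using assms by (simp add: profile_def)
qed

lemma decomposition:
  assumes "a > 0" "b > 0" "t > 0"
  shows "q a b t = t * (profile (a * t) + profile (b * t)) + defect a b"
  using exchange[of 1 t a b] assms by (simp add: defect_def diagonal algebra_simps)

lemma defect_commute: "a > 0 \<Longrightarrow> b > 0 \<Longrightarrow> defect a b = defect b a"
  using symmetric[of a b 1] by (simp add: defect_def)

lemma defect_self: "a > 0 \<Longrightarrow> defect a a = 0"
  using diagonal[of a 1] by (simp add: defect_def)

lemma defect_homogeneous:
  assumes "l > 0" "a > 0" "b > 0"
  shows "defect (l * a) (l * b) = defect a b / l"
  using homogeneous[of l a b 1] decomposition[of "l * a" "l * b" "1 / l"] decomposition[of a b 1]
    assms by (simp add: field_simps)

text \<open>The isosceles triangles \<open>s = t\<close>, in the parameters \<open>x = s / (p + 1)\<close> and \<open>y = p x\<close>.\<close>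
lemma profile_add:
  assumes "x > 0" "y > 0"
  shows "(x + y) * profile (x + y) =
    x * profile x + (2 * x + y) * profile y + (x + y) * x / y * defect (x + y) x"
proof -
  define s p where "s = x + y" and "p = y / x"
  have pos: "s > 0" "p > 0" using assms by (auto simp: s_def p_def)
  have x_eq: "s / (p + 1) = x" using assms by (simp add: s_def p_def field_simps)
  have y_eq: "p * x = y" using assms by (simp add: p_def)
  have "x * (profile x + profile y) - s * (profile s + profile (p * s))
      + s / p * (p * (profile (p * s) + profile y) + defect s x) = 0"
    using triangle[OF pos(2,1,1)] pos assms y_eq by (simp add: x_eq decomposition mult.commute)
  moreover have "s / p * (p * (profile (p * s) + profile y) + defect s x)
      = s * (profile (p * s) + profile y) + s * x / y * defect s x"
    using assms pos by (simp add: distrib_left) (simp add: p_def)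
  ultimately show ?thesis by (simp add: s_def algebra_simps)
qed

lemma profile_eq:
  obtains C E where "\<And>z. z > 0 \<Longrightarrow> profile z = C * z + E / z"
proof -
  define W where "W z = profile z / z" for z
  define R where
    "R x y = (x + y) * (y / x * defect (x + y) y - x / y * defect (x + y) x) / (2 * x * y)" for x y
  have W_diff: "W y - W x = R x y" if "x > 0" "y > 0" for x y
  proof -
    have "2 * x * profile y - 2 * y * profile x
        = (x + y) * (y / x * defect (x + y) y - x / y * defect (x + y) x)"
      using profile_add[OF that] profile_add[OF that(2,1)] by (simp add: add.commute algebra_simps)
    then have "R x y = (2 * x * profile y - 2 * y * profile x) / (2 * x * y)" by (simp only: R_def)
    then show ?thesis using that by (simp add: W_def diff_divide_distrib)
  qed
  have "R (l * x) (l * y) = R x y / l\<^sup>2" if "l > 0" "x > 0" "y > 0" for l x y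
  proof -
    have "defect (l * x + l * y) (l * z) = defect (x + y) z / l" if "z > 0" for z
      using defect_homogeneous[of l "x + y" z] \<open>l > 0\<close> \<open>x > 0\<close> \<open>y > 0\<close> that
      by (simp add: distrib_left)
    then show ?thesis
      using that by (simp add: R_def power2_eq_square) (simp add: field_simps)
  qed
  then have "W (l * x) - W (l * y) = (W x - W y) / l\<^sup>2" if "l > 0" "x > 0" "y > 0" for l x y
    using that by (simp add: W_diff)
  then obtain C E where "\<And>z. z > 0 \<Longrightarrow> W z = C + E / z\<^sup>2"
    using homogeneous_difference_imp_inverse_square[of W] by blast
  then have "profile z = C * z + E / z" if "z > 0" for z
    using that by (auto simp: W_def field_simps power2_eq_square)
  then show thesis using that by blast
qed

lemma kernel_quadratic:
  obtains C where "\<And>a b t. a > 0 \<Longrightarrow> b > 0 \<Longrightarrow> t > 0 \<Longrightarrow> q a b t = C * t\<^sup>2 * (a + b)"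
proof -
  obtain C E where profile_CE: "\<And>z. z > 0 \<Longrightarrow> profile z = C * z + E / z" using profile_eq by blast
  have "E = 0"
    using triangle[of 2 3 1] by (simp add: decomposition defect_self profile_CE)
  then have profile: "profile z = C * z" if "z > 0" for z using profile_CE that by simp
  have defect_less: "defect a b = 0" if "0 < b" "b < a" for a b
  proof -
    have "a * b / (a - b) * defect a b = 0"
      using profile_add[of b "a - b"] that by (simp add: profile algebra_simps)
    then show ?thesis using that by simp
  qed
  have defect: "defect a b = 0" if "a > 0" "b > 0" for a b
    using that defect_less[of b a] defect_less[of a b] defect_self[of a] defect_commute[of a b]
    by (cases a b rule: linorder_cases) auto
  have "q a b t = C * t\<^sup>2 * (a + b)" if "a > 0" "b > 0" "t > 0" for a b t
    using that by (simp add: decomposition profile defect algebra_simps power2_eq_square)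
  then show thesis using that by blast
qed

end

section \<open>Polygons around the origin\<close>

lemma convex_hull_insert_segment_point:
  assumes "z \<in> closed_segment x y" "x \<in> S" "y \<in> S"
  shows "convex hull (insert z S) = convex hull S"
proof (rule hull_redundant)
  have "closed_segment x y \<subseteq> convex hull S"
    using assms by (intro closed_segment_subset) (auto simp: hull_inc)
  then show "z \<in> convex hull S" using assms(1) by blast
qed

lemma zero_in_interior_iff:
  fixes S :: "'a::euclidean_space set"
  assumes convex: "convex S"
  shows "0 \<in> interior S \<longleftrightarrow> (\<forall>w. w \<noteq> 0 \<longrightarrow> (\<exists>y\<in>S. w \<bullet> y < 0))"
proof
  assume "0 \<in> interior S"
  then obtain e where ball: "e > 0" "cball 0 e \<subseteq> S" by (meson mem_interior_cball)
  show "\<forall>w. w \<noteq> 0 \<longrightarrow> (\<exists>y\<in>S. w \<bullet> y < 0)"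
  proof (intro allI impI)
    fix w :: 'a assume "w \<noteq> 0"
    then have "- (e / norm w) *\<^sub>R w \<in> S" "w \<bullet> (- (e / norm w) *\<^sub>R w) < 0"
      using ball by (auto simp: subset_iff)
    then show "\<exists>y\<in>S. w \<bullet> y < 0" by blast
  qed
next
  assume separated: "\<forall>w. w \<noteq> 0 \<longrightarrow> (\<exists>y\<in>S. w \<bullet> y < 0)"
  have "0 \<in> S" using separating_hyperplane_set_0[OF convex] separated by force
  have nonempty: "interior S \<noteq> {}"
  proof
    assume "interior S = {}"
    then obtain a b where "a \<noteq> 0" "S \<subseteq> {x. a \<bullet> x = b}"
      using empty_interior_subset_hyperplane[OF convex] by metis
    moreover from this have "b = 0" using \<open>0 \<in> S\<close> by auto
    ultimately show False using separated by fastforce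
  qed
  show "0 \<in> interior S"
  proof (rule ccontr)
    assume "0 \<notin> interior S"
    then have "0 \<notin> rel_interior S" using rel_interior_nonempty_interior[OF nonempty] by simp
    moreover have "0 \<in> closure S" using \<open>0 \<in> S\<close> closure_subset by auto
    ultimately obtain a where support: "a \<noteq> 0" "\<And>y. y \<in> closure S \<Longrightarrow> a \<bullet> 0 \<le> a \<bullet> y"
      using supporting_hyperplane_relative_frontier[OF convex] by metis
    obtain y where "y \<in> S" "a \<bullet> y < 0" using separated support(1) by blast
    then show False using support(2)[of y] closure_subset[of S] by auto
  qed
qed

lemma zero_in_interior_hull_iff:
  fixes T :: "'a::euclidean_space set"
  shows "0 \<in> interior (convex hull T) \<longleftrightarrow> (\<forall>w. w \<noteq> 0 \<longrightarrow> (\<exists>y\<in>T. w \<bullet> y < 0))"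
proof -
  have "(\<exists>y\<in>convex hull T. w \<bullet> y < 0) \<longleftrightarrow> (\<exists>y\<in>T. w \<bullet> y < 0)" for w
  proof -
    have "convex hull T \<subseteq> {y. w \<bullet> y \<ge> 0} \<longleftrightarrow> T \<subseteq> {y. w \<bullet> y \<ge> 0}"
      by (simp add: subset_hull convex_halfspace_ge)
    then show ?thesis by (auto simp: subset_iff not_less[symmetric])
  qed
  then show ?thesis by (simp add: zero_in_interior_iff)
qed

lemma hull_in_polygons_o:
  "finite T \<Longrightarrow> 0 \<in> interior (convex hull T) \<Longrightarrow> convex hull T \<in> polygons_o"
  by (auto simp: polygons_o_def)

lemma polygons_oD:
  assumes "P \<in> polygons_o"
  shows "compact P" "convex P" "0 \<in> interior P" "0 \<in> P"
  using assms interior_subset by (auto simp: polygons_o_def finite_imp_compact_convex_hull)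

definition pt :: "real \<Rightarrow> real \<Rightarrow> R2" where "pt x y = vector [x, y]"

lemma pt_nth [simp]: "pt x y $ 1 = x" "pt x y $ 2 = y"
  by (auto simp: pt_def)

lemma R2_eq_iff: "(x::R2) = y \<longleftrightarrow> x $ 1 = y $ 1 \<and> x $ 2 = y $ 2"
  by (simp add: vec_eq_iff forall_2)

lemma pt_0_0 [simp]: "pt 0 0 = 0"
  by (simp add: R2_eq_iff)

lemma pt_set_eqI:
  assumes "\<And>x y. pt x y \<in> S \<longleftrightarrow> pt x y \<in> T"
  shows "S = T"
proof (rule set_eqI)
  fix z :: R2
  have "pt (z $ 1) (z $ 2) = z" by (simp add: R2_eq_iff)
  then show "z \<in> S \<longleftrightarrow> z \<in> T" using assms by metis
qed

lemma inner_R2: "(x::R2) \<bullet> y = x $ 1 * y $ 1 + x $ 2 * y $ 2"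
  by (simp add: inner_vec_def sum_2)

lemma rot90_nth [simp]: "rot90 x $ 1 = - (x $ 2)" "rot90 x $ 2 = x $ 1"
  by (auto simp: rot90_def)

lemma linear_rot90: "linear rot90"
  by (rule linearI) (auto simp: R2_eq_iff)

lemma rot90_eq_0_iff [simp]: "rot90 x = 0 \<longleftrightarrow> x = 0"
  by (auto simp: R2_eq_iff)

lemma inner_rot90_self [simp]: "rot90 x \<bullet> x = 0"
  by (simp add: inner_R2)

lemma rot90_orthogonal_imp_scaleR:
  assumes "rot90 p \<bullet> u = 0" "p \<noteq> 0"
  obtains r where "u = r *\<^sub>R p"
proof
  have "(p \<bullet> p) *\<^sub>R u = (p \<bullet> u) *\<^sub>R p + (rot90 p \<bullet> u) *\<^sub>R rot90 p"
    by (simp add: R2_eq_iff inner_R2 algebra_simps)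
  then have "(p \<bullet> p) *\<^sub>R u = (p \<bullet> u) *\<^sub>R p" using assms(1) by simp
  then show "u = ((p \<bullet> u) / (p \<bullet> p)) *\<^sub>R p"
    using assms(2) by (metis divide_inverse inner_eq_zero_iff mult.commute scaleR_left_imp_eq
        scaleR_scaleR right_inverse scaleR_one)
qed

lemma matrix_R2_nth: "((A::real^2^2) *v x) $ i = A $ i $ 1 * x $ 1 + A $ i $ 2 * x $ 2"
  by (simp add: matrix_vector_mult_def sum_2)

lemma rot90_mult_matrix: "rot90 (A *v x) v* A = det A *\<^sub>R rot90 x"
  by (simp add: R2_eq_iff matrix_R2_nth vector_matrix_mult_def sum_2 det_2 algebra_simps)

lemma inner_rot90_mult: "rot90 (A *v x) \<bullet> (A *v y) = det A * (rot90 x \<bullet> y)"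
  by (metis dot_lmul_matrix rot90_mult_matrix inner_scaleR_left)

definition mat2 :: "real \<Rightarrow> real \<Rightarrow> real \<Rightarrow> real \<Rightarrow> real^2^2" where
  "mat2 a b c d = vector [vector [a, b], vector [c, d]]"

lemma mat2_nth [simp]:
  "mat2 a b c d $ 1 $ 1 = a" "mat2 a b c d $ 1 $ 2 = b"
  "mat2 a b c d $ 2 $ 1 = c" "mat2 a b c d $ 2 $ 2 = d"
  by (auto simp: mat2_def)

lemma det_mat2 [simp]: "det (mat2 a b c d) = a * d - b * c"
  by (simp add: det_2)

lemma mat2_mult_pt [simp]: "mat2 a b c d *v pt x y = pt (a * x + b * y) (c * x + d * y)"
  by (simp add: R2_eq_iff matrix_R2_nth)

lemma VL2_invertible: "A \<in> VL2 \<Longrightarrow> invertible A"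
  by (auto simp: VL2_def invertible_det_nz)

lemma matrix_image_hull:
  fixes A :: "real^'n^'m"
  shows "(*v) A ` (convex hull S) = convex hull ((*v) A ` S)"
  by (rule convex_hull_linear_image) simp

lemma zero_in_interior_hull_diagonal:
  assumes zero_between: "0 \<in> open_segment p q" and opposite: "(rot90 p \<bullet> u) * (rot90 p \<bullet> v) < 0"
  shows "0 \<in> interior (convex hull {p, q, u, v})"
  unfolding zero_in_interior_hull_iff
proof (intro allI impI)
  fix w :: R2 assume w_nonzero: "w \<noteq> 0"
  obtain k where k_range: "0 < k" "k < 1" and combination: "(1 - k) *\<^sub>R p + k *\<^sub>R q = 0"
    using zero_between by (auto simp: in_segment)
  have "(1 - k) * (w \<bullet> p) + k * (w \<bullet> q) = 0"
    using arg_cong[OF combination, of "\<lambda>z. w \<bullet> z"] by (simp add: inner_add_right)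
  then have "w \<bullet> q < 0" if "w \<bullet> p > 0"
    using that k_range mult_pos_pos[of "1 - k" "w \<bullet> p"] by (simp add: add_eq_0_iff2 mult_less_0_iff)
  moreover have "w \<bullet> u < 0 \<or> w \<bullet> v < 0" if orth: "w \<bullet> p = 0"
  proof -
    have "p \<noteq> 0" using opposite by (auto simp: inner_R2)
    moreover have "rot90 (rot90 p) \<bullet> w = - (w \<bullet> p)" by (simp add: inner_R2)
    ultimately obtain r where w_eq: "w = r *\<^sub>R rot90 p"
      using rot90_orthogonal_imp_scaleR[of "rot90 p" w] orth by auto
    have "(w \<bullet> u) * (w \<bullet> v) = r\<^sup>2 * ((rot90 p \<bullet> u) * (rot90 p \<bullet> v))"
      by (simp add: w_eq power2_eq_square)
    also have "\<dots> < 0" by (rule mult_pos_neg[OF _ opposite]) (use w_eq w_nonzero in auto)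
    finally show ?thesis by (auto simp: mult_less_0_iff)
  qed
  ultimately show "\<exists>y\<in>{p, q, u, v}. w \<bullet> y < 0" by fastforce
qed

section \<open>Quadrilaterals with a horizontal diagonal through the origin\<close>

definition quad :: "real \<Rightarrow> real \<Rightarrow> real \<Rightarrow> real \<Rightarrow> real \<Rightarrow> real \<Rightarrow> R2 set" where
  "quad a b c t d s = convex hull {pt b 0, pt (- a) 0, pt (c * t) t, pt (d * s) (- s)}"

lemma pt_0_in_closed_segment:
  assumes "- a \<le> x" "x \<le> b"
  shows "pt x 0 \<in> closed_segment (pt (- a) 0) (pt b 0)"
proof -
  have "pt y 0 = y *\<^sub>R pt 1 0" for y by (simp add: R2_eq_iff)
  moreover have "x \<in> closed_segment (- a) b" using assms by (simp add: closed_segment_eq_real_ivl)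
  ultimately show ?thesis
    by (metis closed_segment_linear_image image_eqI linear_scaleR_left)
qed

lemma pt_0_in_segment_across:
  assumes "v > 0" "w > 0" "x * (v + w) = w * u + v * u'"
  shows "pt x 0 \<in> closed_segment (pt u v) (pt u' (- w))"
proof -
  define k where "k = v / (v + w)"
  have k_props: "0 \<le> k" "k \<le> 1" "k * (v + w) = v" using assms by (auto simp: k_def)
  have complement: "(1 - k) * (v + w) = w" using k_props(3) by (simp add: algebra_simps)
  have "((1 - k) * u + k * u') * (v + w) = (1 - k) * (v + w) * u + k * (v + w) * u'" by algebra
  then have "x * (v + w) = ((1 - k) * u + k * u') * (v + w)"
    unfolding k_props complement using assms(3) by simp
  then have "x = (1 - k) * u + k * u'" using assms(1,2) by simp
  moreover have "(1 - k) * v + k * (- w) = 0" using k_props(3) by (simp add: algebra_simps)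
  ultimately show ?thesis
    using k_props by (auto simp: in_segment R2_eq_iff intro!: exI[of _ k])
qed

lemma zero_in_open_segment_horizontal:
  assumes "a > 0" "b > 0"
  shows "0 \<in> open_segment (pt b 0) (pt (- a) 0)"
  using pt_0_in_closed_segment[of a 0 b] assms
  by (auto simp: open_segment_def closed_segment_commute R2_eq_iff)

lemma quad_in_polygons_o:
  assumes "a > 0" "b > 0" "t > 0" "s > 0"
  shows "quad a b c t d s \<in> polygons_o"
  unfolding quad_def using assms
  by (intro hull_in_polygons_o zero_in_interior_hull_diagonal zero_in_open_segment_horizontal)
    (auto simp: inner_R2 mult_less_0_iff)

text \<open>The inequalities express weak convexity at the vertices \<open>(b, 0)\<close> and \<open>(-a, 0)\<close>.\<close>
definition convex_quad :: "real \<Rightarrow> real \<Rightarrow> real \<Rightarrow> real \<Rightarrow> real \<Rightarrow> real \<Rightarrow> bool" where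
  "convex_quad a b c t d s \<longleftrightarrow> a > 0 \<and> b > 0 \<and> t > 0 \<and> s > 0 \<and>
     c - b / t \<le> b / s - d \<and> - d - a / s \<le> c + a / t"

lemma convex_quad_positive:
  assumes "convex_quad a b c t d s"
  shows "a > 0" "b > 0" "t > 0" "s > 0"
  using assms by (auto simp: convex_quad_def)

lemma convex_quad_flip: "convex_quad a b c t d s \<Longrightarrow> convex_quad a b d s c t"
  by (auto simp: convex_quad_def)

lemma convex_quad_mirror: "convex_quad a b c t d s \<Longrightarrow> convex_quad b a (- c) t (- d) s"
  by (auto simp: convex_quad_def)

lemma convex_quad_upright:
  assumes "a > 0" "b > 0" "t > 0" "s > 0" "0 \<le> c" "c \<le> b / t + b / s"
  shows "convex_quad a b c t 0 s"
proof -
  have "0 < a / s" "0 < a / t" using assms by auto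
  then show ?thesis unfolding convex_quad_def using assms by (intro conjI; linarith)
qed

lemma convex_quad_crossing:
  assumes pos: "a > 0" "b > 0" "t > 0" "s > 0" and x_range: "- a \<le> x" "x \<le> b"
    and crossing: "pt x 0 \<in> closed_segment (pt (c * t) t) (pt (d * s) (- s))"
  shows "convex_quad a b c t d s"
proof -
  obtain k where crossing_eqs: "(1 - k) * (c * t) + k * (d * s) = x" "(1 - k) * t = k * s"
    using crossing by (auto simp: in_segment R2_eq_iff)
  have "x = (k * s) * (c + d)" using crossing_eqs by (metis distrib_left mult.assoc mult.commute)
  moreover have "(k * s) * (1 / s + 1 / t) = k + (1 - k) * t / t"
    unfolding crossing_eqs(2) using pos by (simp add: distrib_left)
  then have "(k * s) * (1 / s + 1 / t) = 1" using pos by simp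
  ultimately have sum: "c + d = x * (1 / s + 1 / t)"
    by (metis mult.assoc mult.commute mult_1)
  have "1 / s + 1 / t > 0" using pos by (simp add: add_pos_pos)
  then have "c + d \<le> b * (1 / s + 1 / t)" "- a * (1 / s + 1 / t) \<le> c + d"
    unfolding sum by (intro mult_right_mono x_range; simp)+
  then show ?thesis using pos by (simp add: convex_quad_def algebra_simps)
qed

lemma quad_flip: "(*v) (mat2 1 0 0 (- 1)) ` quad a b c t d s = quad a b d s c t"
  by (simp add: quad_def matrix_image_hull insert_commute)

lemma pt_in_hull_horizontal_triangle:
  assumes pos: "a > 0" "b > 0" "t \<noteq> 0" and y_side: "0 \<le> y / t"
    and x_between: "- a + y * (c + a / t) \<le> x" "x \<le> b + y * (c - b / t)"
  shows "pt x y \<in> convex hull {pt b 0, pt (- a) 0, pt (c * t) t}"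
proof -
  define n l m where "n = y / t" and "l = (a * (1 - n) + (x - c * y)) / (a + b)"
    and "m = (b * (1 - n) - (x - c * y)) / (a + b)"
  have "n \<ge> 0" using y_side by (simp add: n_def)
  have "a * n = y * (a / t)" "b * n = y * (b / t)" by (simp_all add: n_def)
  then have "l \<ge> 0" "m \<ge> 0"
    using pos x_between by (auto simp: l_def m_def algebra_simps)
  have "l * (a + b) = a * (1 - n) + (x - c * y)" "m * (a + b) = b * (1 - n) - (x - c * y)"
    using pos by (auto simp: l_def m_def)
  then have "(l + m + n) * (a + b) = 1 * (a + b)"
    "(l * b - m * a) * (a + b) = (x - c * y) * (a + b)"
    by algebra+
  then have "l + m + n = 1" "l * b - m * a = x - c * y"
    using pos by (simp_all only: mult_cancel_right) auto
  moreover have "n * t = y" using pos by (simp add: n_def)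
  ultimately have "pt x y = l *\<^sub>R pt b 0 + m *\<^sub>R pt (- a) 0 + n *\<^sub>R pt (c * t) t"
    by (simp add: R2_eq_iff algebra_simps)
  then show ?thesis
    unfolding convex_hull_3 using \<open>l \<ge> 0\<close> \<open>m \<ge> 0\<close> \<open>n \<ge> 0\<close> \<open>l + m + n = 1\<close> by blast
qed

lemma mem_quad_upper_iff:
  assumes convex: "convex_quad a b c t d s" and upper: "y \<ge> 0"
  shows "pt x y \<in> quad a b c t d s \<longleftrightarrow> - a + y * (c + a / t) \<le> x \<and> x \<le> b + y * (c - b / t)"
proof
  note pos = convex_quad_positive[OF convex]
  define right left where "right = pt 1 (- (c - b / t))" and "left = pt (- 1) (c + a / t)"
  have "s * (c - b / t) \<le> s * (b / s - d)" "s * (- d - a / s) \<le> s * (c + a / t)"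
    using convex pos by (auto simp: convex_quad_def intro: mult_left_mono)
  then have "quad a b c t d s \<subseteq> {z. right \<bullet> z \<le> b} \<inter> {z. left \<bullet> z \<le> a}"
    unfolding quad_def using pos
    by (intro hull_minimal convex_Int convex_halfspace_le)
      (auto simp: right_def left_def inner_R2 algebra_simps)
  then show "- a + y * (c + a / t) \<le> x \<and> x \<le> b + y * (c - b / t)"
    if "pt x y \<in> quad a b c t d s"
    using that by (auto simp: right_def left_def inner_R2 algebra_simps)
next
  assume "- a + y * (c + a / t) \<le> x \<and> x \<le> b + y * (c - b / t)"
  then have "pt x y \<in> convex hull {pt b 0, pt (- a) 0, pt (c * t) t}"
    using upper convex_quad_positive[OF convex] by (intro pt_in_hull_horizontal_triangle) auto
  also have "\<dots> \<subseteq> quad a b c t d s" unfolding quad_def by (intro hull_mono) auto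
  finally show "pt x y \<in> quad a b c t d s" .
qed

lemma mem_quad_lower_iff:
  assumes convex: "convex_quad a b c t d s" and lower: "y \<le> 0"
  shows "pt x y \<in> quad a b c t d s \<longleftrightarrow> - a - y * (d + a / s) \<le> x \<and> x \<le> b - y * (d - b / s)"
proof -
  let ?M = "mat2 1 0 0 (- 1)"
  have "pt x y \<in> quad a b c t d s \<longleftrightarrow> ?M *v pt x y \<in> (*v) ?M ` quad a b c t d s"
    by (intro inj_image_mem_iff[symmetric] inj_matrix_vector_mult VL2_invertible)
      (simp add: VL2_def)
  also have "\<dots> \<longleftrightarrow> pt x (- y) \<in> quad a b d s c t" by (simp add: quad_flip)
  also have "\<dots> \<longleftrightarrow> - a - y * (d + a / s) \<le> x \<and> x \<le> b - y * (d - b / s)"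
    using mem_quad_upper_iff[OF convex_quad_flip[OF convex], of "- y" x] lower by simp
  finally show ?thesis .
qed

lemma quad_Un_Int:
  assumes convex: "convex_quad a b c t d s" and pos: "t' > 0" "s' > 0"
    and upper: "c' - b / t' \<le> c - b / t" "c + a / t \<le> c' + a / t'"
    and lower: "d' - b / s' \<le> d - b / s" "d + a / s \<le> d' + a / s'"
  shows "quad a b c t d' s' \<union> quad a b c' t' d s = quad a b c t d s"
    and "quad a b c t d' s' \<inter> quad a b c' t' d s = quad a b c' t' d' s'"
proof -
  have parts: "convex_quad a b c t d' s'" "convex_quad a b c' t' d s" "convex_quad a b c' t' d' s'"
    using convex pos upper lower by (auto simp: convex_quad_def)
  have Un_Int:
    "(pt x y \<in> quad a b c t d' s' \<or> pt x y \<in> quad a b c' t' d s \<longleftrightarrow> pt x y \<in> quad a b c t d s) \<and>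
     (pt x y \<in> quad a b c t d' s' \<and> pt x y \<in> quad a b c' t' d s \<longleftrightarrow> pt x y \<in> quad a b c' t' d' s')"
    for x y
  proof (cases "y \<ge> 0")
    case True
    have "y * (c' - b / t') \<le> y * (c - b / t)" "y * (c + a / t) \<le> y * (c' + a / t')"
      by (intro mult_left_mono True upper)+
    then have "- a + y * (c + a / t) \<le> x \<and> x \<le> b + y * (c - b / t)"
      if "- a + y * (c' + a / t') \<le> x \<and> x \<le> b + y * (c' - b / t')" using that by linarith
    then show ?thesis
      unfolding mem_quad_upper_iff[OF convex True] mem_quad_upper_iff[OF parts(1) True]
        mem_quad_upper_iff[OF parts(2) True] mem_quad_upper_iff[OF parts(3) True] by blast
  next
    case False
    then have below: "y \<le> 0" by simp
    have "y * (d - b / s) \<le> y * (d' - b / s')" "y * (d' + a / s') \<le> y * (d + a / s)"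
      by (intro mult_left_mono_neg below lower)+
    then have "- a - y * (d + a / s) \<le> x \<and> x \<le> b - y * (d - b / s)"
      if "- a - y * (d' + a / s') \<le> x \<and> x \<le> b - y * (d' - b / s')" using that by linarith
    then show ?thesis
      unfolding mem_quad_lower_iff[OF convex below] mem_quad_lower_iff[OF parts(1) below]
        mem_quad_lower_iff[OF parts(2) below] mem_quad_lower_iff[OF parts(3) below] by blast
  qed
  show "quad a b c t d' s' \<union> quad a b c' t' d s = quad a b c t d s"
    by (rule pt_set_eqI) (use Un_Int in blast)
  show "quad a b c t d' s' \<inter> quad a b c' t' d s = quad a b c' t' d' s'"
    by (rule pt_set_eqI) (use Un_Int in blast)
qed

text \<open>Six times the moment vector of \<^const>\<open>quad\<close>, from the areas and centroids of its two
  halves.\<close>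
definition scaled_quad_moment ::
    "real \<Rightarrow> real \<Rightarrow> real \<Rightarrow> real \<Rightarrow> real \<Rightarrow> real \<Rightarrow> R2" where
  "scaled_quad_moment a b c t d s =
     pt ((b\<^sup>2 - a\<^sup>2) * (s + t) + (a + b) * (c * t\<^sup>2 + d * s\<^sup>2)) ((a + b) * (t\<^sup>2 - s\<^sup>2))"

lemma eventually_le_divide_at_right_0:
  fixes a K :: real
  assumes "a > 0"
  shows "\<forall>\<^sub>F r in at_right 0. K \<le> a / r"
proof -
  have "filterlim (\<lambda>r. a * inverse r) at_top (at_right 0)"
    by (rule filterlim_tendsto_pos_mult_at_top[OF tendsto_const assms
          filterlim_inverse_at_top_right])
  then show ?thesis by (simp add: filterlim_at_top divide_inverse)
qed

locale covariant_valuation =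
  fixes nu :: "R2 set \<Rightarrow> R2"
  assumes valuation: "is_valuation_on polygons_o nu"
    and covariant: "A \<in> VL2 \<Longrightarrow> P \<in> polygons_o \<Longrightarrow> nu ((*v) A ` P) = A *v nu P"
begin

abbreviation nu_quad :: "real \<Rightarrow> real \<Rightarrow> real \<Rightarrow> real \<Rightarrow> real \<Rightarrow> real \<Rightarrow> R2" where
  "nu_quad a b c t d s \<equiv> nu (quad a b c t d s)"

lemma nu_quad_nested:
  assumes convex: "convex_quad a b c t d s" and pos: "t' > 0" "s' > 0"
    and upper: "c' - b / t' \<le> c - b / t" "c + a / t \<le> c' + a / t'"
    and lower: "d' - b / s' \<le> d - b / s" "d + a / s \<le> d' + a / s'"
  shows "nu_quad a b c t d s =
    nu_quad a b c t d' s' + nu_quad a b c' t' d s - nu_quad a b c' t' d' s'"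
proof -
  have "quad a b c t d s \<in> polygons_o" "quad a b c t d' s' \<in> polygons_o"
      "quad a b c' t' d s \<in> polygons_o" "quad a b c' t' d' s' \<in> polygons_o"
    using convex_quad_positive[OF convex] pos by (auto intro: quad_in_polygons_o)
  then have "nu_quad a b c t d s + nu_quad a b c' t' d' s'
      = nu_quad a b c t d' s' + nu_quad a b c' t' d s"
    using valuation[unfolded is_valuation_on_def, rule_format,
        of "quad a b c t d' s'" "quad a b c' t' d s"] quad_Un_Int[OF convex pos upper lower] by simp
  then show ?thesis by (simp add: algebra_simps)
qed

lemma eventually_nu_quad_split:
  assumes convex: "convex_quad a b c t d s"
  shows "\<forall>\<^sub>F r in at_right 0.
    nu_quad a b c t d s = nu_quad a b c t 0 r + nu_quad a b 0 r d s - nu_quad a b 0 r 0 r"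
proof -
  have "\<forall>\<^sub>F r in at_right 0. r > 0 \<and> - (c - b / t) \<le> b / r \<and> c + a / t \<le> a / r \<and>
      - (d - b / s) \<le> b / r \<and> d + a / s \<le> a / r"
    using convex_quad_positive[OF convex]
    by (intro eventually_conj eventually_le_divide_at_right_0 eventually_at_right_less)
  then show ?thesis
    by eventually_elim (rule nu_quad_nested[OF convex]; simp)
qed

lemma nu_quad_exchange:
  assumes "convex_quad a b c t d s" "convex_quad a b c' t' d s"
    "convex_quad a b c t d' s'" "convex_quad a b c' t' d' s'"
  shows "nu_quad a b c t d s - nu_quad a b c' t' d s
    = nu_quad a b c t d' s' - nu_quad a b c' t' d' s'"
proof -
  have "\<forall>\<^sub>F r in at_right (0::real). nu_quad a b c t d s - nu_quad a b c' t' d s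
      = nu_quad a b c t d' s' - nu_quad a b c' t' d' s'"
    using assms[THEN eventually_nu_quad_split] by eventually_elim simp
  then show ?thesis by simp
qed

lemma nu_quad_linear_image:
  assumes "a > 0" "b > 0" "t > 0" "s > 0" "A \<in> VL2"
    and "(*v) A ` {pt b 0, pt (- a) 0, pt (c * t) t, pt (d * s) (- s)}
        = {pt b' 0, pt (- a') 0, pt (c' * t') t', pt (d' * s') (- s')}"
  shows "nu_quad a' b' c' t' d' s' = A *v nu_quad a b c t d s"
proof -
  have "(*v) A ` quad a b c t d s = quad a' b' c' t' d' s'"
    unfolding quad_def matrix_image_hull assms(6) ..
  then show ?thesis
    using covariant[OF assms(5) quad_in_polygons_o[OF assms(1-4)], of c d] by simp
qed

lemma nu_quad_shear:
  assumes "a > 0" "b > 0" "t > 0" "s > 0"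
  shows "nu_quad a b (c + e) t (d - e) s = mat2 1 e 0 1 *v nu_quad a b c t d s"
  by (rule nu_quad_linear_image) (use assms in \<open>auto simp: VL2_def algebra_simps\<close>)

lemma nu_quad_flip:
  assumes "a > 0" "b > 0" "t > 0" "s > 0"
  shows "nu_quad a b d s c t = mat2 1 0 0 (- 1) *v nu_quad a b c t d s"
  by (rule nu_quad_linear_image) (use assms in \<open>auto simp: VL2_def\<close>)

lemma nu_quad_mirror:
  assumes "a > 0" "b > 0" "t > 0" "s > 0"
  shows "nu_quad b a (- c) t (- d) s = mat2 (- 1) 0 0 1 *v nu_quad a b c t d s"
  by (rule nu_quad_linear_image) (use assms in \<open>auto simp: VL2_def\<close>)

lemma nu_quad_scale:
  assumes "a > 0" "b > 0" "t > 0" "s > 0" "l > 0"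
  shows "nu_quad (l * a) (l * b) (l\<^sup>2 * c) (t / l) (l\<^sup>2 * d) (s / l)
    = mat2 l 0 0 (1 / l) *v nu_quad a b c t d s"
  by (rule nu_quad_linear_image) (use assms in \<open>auto simp: VL2_def power2_eq_square\<close>)

lemma nu_quad_swap:
  assumes "a > 0" "b > 0" "t > 0" "s > 0"
  shows "nu_quad s t 0 b 0 a = mat2 0 1 1 0 *v nu_quad a b 0 t 0 s"
  by (rule nu_quad_linear_image) (use assms in \<open>auto simp: VL2_def\<close>)

text \<open>A triangle cut along the line through one vertex and the origin and, after a quarter turn,
  along the line through another.\<close>
lemma nu_quad_triangle:
  assumes pos: "p > 0" "s > 0" "t > 0"
  defines "b \<equiv> p * t / (s + t)" and "b' \<equiv> s / (p + 1)"
  shows "convex_quad 1 b 0 t (p / s) s" "convex_quad t b' (s / p) p 0 1"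
    "nu_quad t b' (s / p) p 0 1 = mat2 0 (- 1) 1 0 *v nu_quad 1 b 0 t (p / s) s"
proof -
  have b_pos: "b > 0" "b' > 0" using pos by (auto simp: b_def b'_def add_pos_pos)
  have b_eq: "b * (t + s) = p * t" "b' * (p + 1) = s"
    using pos by (auto simp: b_def b'_def add.commute)
  have on_diagonal: "pt b 0 \<in> closed_segment (pt (0 * t) t) (pt (p / s * s) (- s))"
    using pos b_eq by (intro pt_0_in_segment_across) auto
  have on_turned_diagonal: "pt b' 0 \<in> closed_segment (pt (s / p * p) p) (pt (0 * 1) (- 1))"
    using pos b_eq by (intro pt_0_in_segment_across) auto
  show "convex_quad 1 b 0 t (p / s) s"
    by (rule convex_quad_crossing[OF _ _ _ _ _ _ on_diagonal]) (use pos b_pos in auto)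
  show "convex_quad t b' (s / p) p 0 1"
    by (rule convex_quad_crossing[OF _ _ _ _ _ _ on_turned_diagonal]) (use pos b_pos in auto)
  have "quad 1 b 0 t (p / s) s = convex hull {pt (- 1) 0, pt (0 * t) t, pt (p / s * s) (- s)}"
    unfolding quad_def using on_diagonal by (rule convex_hull_insert_segment_point) auto
  moreover have "quad t b' (s / p) p 0 1 =
      convex hull {pt (- t) 0, pt (s / p * p) p, pt (0 * 1) (- 1)}"
    unfolding quad_def using on_turned_diagonal by (rule convex_hull_insert_segment_point) auto
  ultimately have "(*v) (mat2 0 (- 1) 1 0) ` quad 1 b 0 t (p / s) s = quad t b' (s / p) p 0 1"
    using pos by (simp add: matrix_image_hull insert_commute)
  then show "nu_quad t b' (s / p) p 0 1 = mat2 0 (- 1) 1 0 *v nu_quad 1 b 0 t (p / s) s"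
    using covariant[of "mat2 0 (- 1) 1 0" "quad 1 b 0 t (p / s) s"] pos b_pos
    by (simp add: VL2_def quad_in_polygons_o)
qed

text \<open>The effect on \<^term>\<open>nu\<close> of shearing only the upper half. The lower vertex is chosen close
  enough to the diagonal to preserve convexity; any other such vertex gives the same value.\<close>
definition tilt :: "real \<Rightarrow> real \<Rightarrow> real \<Rightarrow> real \<Rightarrow> R2" where
  "tilt a b t x = (let r = min a b / (1 + \<bar>x\<bar>) in nu_quad a b x t 0 r - nu_quad a b 0 t 0 r)"

lemma convex_quad_shallow:
  assumes pos: "a > 0" "b > 0" "t > 0" "r > 0" and small: "r * (\<bar>x\<bar> + \<bar>y\<bar>) \<le> min a b"
  shows "convex_quad a b x t y r"
proof -
  have "\<bar>x\<bar> + \<bar>y\<bar> \<le> a / r" "\<bar>x\<bar> + \<bar>y\<bar> \<le> b / r"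
    using small pos by (auto simp: pos_le_divide_eq mult.commute)
  moreover have "0 < a / t" "0 < b / t" using pos by auto
  ultimately have "x - b / t \<le> b / r - y" "- y - a / r \<le> x + a / t" by linarith+
  then show ?thesis using pos by (simp add: convex_quad_def)
qed

lemma tilt_eq:
  assumes convex: "convex_quad a b x t d s" "convex_quad a b 0 t d s"
  shows "nu_quad a b x t d s - nu_quad a b 0 t d s = tilt a b t x"
proof -
  note pos = convex_quad_positive[OF convex(1)]
  define r where "r = min a b / (1 + \<bar>x\<bar>)"
  have "r > 0" "r * (1 + \<bar>x\<bar>) = min a b" using pos by (auto simp: r_def)
  then have "convex_quad a b x t 0 r" "convex_quad a b 0 t 0 r"
    using pos by (auto simp: distrib_left intro!: convex_quad_shallow)
  then show ?thesis
    unfolding tilt_def Let_def r_def[symmetric] by (rule nu_quad_exchange[OF convex])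
qed

lemma tilt_add_shear:
  assumes pos: "a > 0" "b > 0" "t > 0"
  shows "tilt a b t (x + y) = tilt a b t y + mat2 1 y 0 1 *v tilt a b t x"
proof -
  define r where "r = min a b / (1 + \<bar>x\<bar> + \<bar>y\<bar>)"
  have "r > 0" using pos by (simp add: r_def add_pos_nonneg)
  have shallow: "convex_quad a b u t v r" if "\<bar>u\<bar> + \<bar>v\<bar> \<le> \<bar>x\<bar> + \<bar>y\<bar>" for u v
  proof (rule convex_quad_shallow[OF pos \<open>r > 0\<close>])
    have "r * (\<bar>u\<bar> + \<bar>v\<bar>) \<le> r * (1 + \<bar>x\<bar> + \<bar>y\<bar>)"
      using \<open>r > 0\<close> that by (intro mult_left_mono) auto
    also have "\<dots> = min a b" by (simp add: r_def add_nonneg_eq_0_iff)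
    finally show "r * (\<bar>u\<bar> + \<bar>v\<bar>) \<le> min a b" .
  qed
  have tilt: "nu_quad a b u t v r - nu_quad a b 0 t v r = tilt a b t u"
    if "\<bar>u\<bar> + \<bar>v\<bar> \<le> \<bar>x\<bar> + \<bar>y\<bar>" for u v
    using that by (intro tilt_eq shallow) auto
  have "tilt a b t (x + y) - tilt a b t y = nu_quad a b (x + y) t 0 r - nu_quad a b y t 0 r"
    using tilt[of "x + y" 0] tilt[of y 0] by (simp add: algebra_simps)
  also have "\<dots> = nu_quad a b (x + y) t (y - y) r - nu_quad a b (0 + y) t (y - y) r"
    by simp
  also have "\<dots> = mat2 1 y 0 1 *v (nu_quad a b x t y r - nu_quad a b 0 t y r)"
    unfolding nu_quad_shear[OF pos \<open>r > 0\<close>] by (simp add: matrix_vector_mult_diff_distrib)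
  also have "\<dots> = mat2 1 y 0 1 *v tilt a b t x"
    using tilt[of x y] by simp
  finally show ?thesis by (simp add: algebra_simps)
qed

lemma tilt_horizontal:
  assumes pos: "a > 0" "b > 0" "t > 0"
  shows "tilt a b t x $ 2 = 0"
proof -
  have symmetric: "nu_quad a b y t 0 t $ 2 = 0" for y
    using nu_quad_shear[OF pos pos(3), of y "- y" 0] nu_quad_flip[OF pos pos(3), of 0 y]
    by (simp add: R2_eq_iff matrix_R2_nth)
  define y where "y = min a b / t"
  have y_small: "y > 0" "t * \<bar>y\<bar> = min a b" using pos by (auto simp: y_def)
  have "convex_quad a b y t 0 t" "convex_quad a b 0 t 0 t"
    using pos y_small by (auto intro!: convex_quad_shallow)
  from tilt_eq[OF this] have "tilt a b t y $ 2 = 0"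
    using symmetric by (metis vector_minus_component diff_self)
  moreover have "x * tilt a b t y $ 2 = y * tilt a b t x $ 2"
    using tilt_add_shear[OF pos, of x y] tilt_add_shear[OF pos, of y x]
    by (simp add: R2_eq_iff matrix_R2_nth add.commute)
  ultimately show ?thesis using y_small by simp
qed

lemma additive_tilt:
  assumes pos: "a > 0" "b > 0" "t > 0"
  shows "Modules.additive (tilt a b t)"
proof
  fix x y
  have "mat2 1 y 0 1 *v tilt a b t x = tilt a b t x"
    by (simp add: R2_eq_iff matrix_R2_nth tilt_horizontal[OF pos])
  then show "tilt a b t (x + y) = tilt a b t x + tilt a b t y"
    by (simp add: tilt_add_shear[OF pos])
qed

end

text \<open>Measurability of \<open>\<mu>\<close> only enters through this regularity, which the moment vector
  satisfies as well.\<close>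
locale regular_covariant_valuation = covariant_valuation +
  assumes regular: "a > 0 \<Longrightarrow> b > 0 \<Longrightarrow> t > 0 \<Longrightarrow> s > 0 \<Longrightarrow>
    bounded_on_nonnegligible {-1..1} (\<lambda>c. nu (quad a b c t 0 s))"
begin

definition slope :: "real \<Rightarrow> real \<Rightarrow> real \<Rightarrow> real" where
  "slope a b t = tilt a b t 1 $ 1"

lemma linear_tilt:
  assumes pos: "a > 0" "b > 0" "t > 0"
  shows "linear (tilt a b t)"
proof -
  define r where "r = min a b"
  have "r > 0" using pos by (simp add: r_def)
  obtain A B where A_nonnegligible: "A \<in> sets lebesgue" "A \<subseteq> {-1..1}" "\<not> negligible A"
    and bound: "\<And>x. x \<in> A \<Longrightarrow> norm (nu_quad a b x t 0 r) \<le> B"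
    using regular[OF pos \<open>r > 0\<close>] by (auto simp: bounded_on_nonnegligible_def bounded_iff)
  have "norm (tilt a b t x) \<le> B + norm (nu_quad a b 0 t 0 r)" if "x \<in> A" for x
  proof -
    have "\<bar>x\<bar> \<le> 1" using A_nonnegligible(2) that by force
    then have "convex_quad a b x t 0 r" "convex_quad a b 0 t 0 r"
      using pos \<open>r > 0\<close> by (auto intro!: convex_quad_shallow simp: r_def[symmetric] mult_left_le)
    from tilt_eq[OF this] show ?thesis
      using norm_triangle_ineq4[of "nu_quad a b x t 0 r" "nu_quad a b 0 t 0 r"] bound[OF that]
      by simp
  qed
  then have "bounded_on_nonnegligible {-1..1} (tilt a b t)"
    using A_nonnegligible unfolding bounded_on_nonnegligible_def bounded_iff by blast
  then show ?thesis by (rule additive_bounded_on_nonnegligible_imp_linear[OF additive_tilt[OF pos]])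
qed

lemma tilt_eq_slope:
  assumes pos: "a > 0" "b > 0" "t > 0"
  shows "tilt a b t x = pt (x * slope a b t) 0"
proof -
  have "tilt a b t x = x *\<^sub>R tilt a b t 1"
    using linear_scale[OF linear_tilt[OF pos], of x 1] by simp
  then show ?thesis by (simp add: R2_eq_iff slope_def tilt_horizontal[OF pos])
qed

lemma nu_quad_tilt:
  assumes convex: "convex_quad a b c t 0 s"
  shows "nu_quad a b c t 0 s = nu_quad a b 0 t 0 s + pt (c * slope a b t) 0"
proof -
  note pos = convex_quad_positive[OF convex]
  have "convex_quad a b 0 t 0 s" using pos by (intro convex_quad_upright) auto
  from tilt_eq[OF convex this] show ?thesis
    using pos by (simp add: tilt_eq_slope algebra_simps)
qed

lemma nu_quad_upright_nth_2:
  assumes pos: "a > 0" "b > 0" "t > 0" "s > 0"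
  shows "nu_quad a b 0 t 0 s $ 2 = slope a b t - slope a b s"
proof -
  define c where "c = b / t"
  have "c > 0" using pos by (simp add: c_def)
  have convex: "convex_quad a b c t 0 s" "convex_quad a b c s 0 t"
    using pos by (auto simp: c_def intro!: convex_quad_upright)
  have "nu_quad a b c s 0 t $ 1 = nu_quad a b c t 0 s $ 1 - c * nu_quad a b c t 0 s $ 2"
    using nu_quad_shear[OF pos, of c "- c" 0] nu_quad_flip[OF pos, of c 0]
      nu_quad_flip[OF pos, of 0 c]
    by (simp add: matrix_R2_nth)
  moreover have "nu_quad a b 0 s 0 t $ 1 = nu_quad a b 0 t 0 s $ 1"
    using nu_quad_flip[OF pos, of 0 0] by (simp add: matrix_R2_nth)
  ultimately have "c * slope a b s = c * (slope a b t - nu_quad a b 0 t 0 s $ 2)"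
    by (simp add: nu_quad_tilt[OF convex(1)] nu_quad_tilt[OF convex(2)] algebra_simps)
  then show ?thesis using \<open>c > 0\<close> by simp
qed

lemma nu_quad_upright:
  assumes pos: "a > 0" "b > 0" "t > 0" "s > 0"
  shows "nu_quad a b 0 t 0 s = pt (slope s t b - slope s t a) (slope a b t - slope a b s)"
proof -
  have "nu_quad a b 0 t 0 s $ 1 = nu_quad s t 0 b 0 a $ 2"
    using nu_quad_swap[OF pos] by (simp add: matrix_R2_nth)
  then show ?thesis using pos by (simp add: R2_eq_iff nu_quad_upright_nth_2)
qed

lemma nu_quad_eq_slope:
  assumes convex: "convex_quad a b c t d s"
  shows "nu_quad a b c t d s = pt (slope s t b - slope s t a + c * slope a b t + d * slope a b s)
    (slope a b t - slope a b s)"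
proof -
  note pos = convex_quad_positive[OF convex]
  have "convex_quad a b (c + d) t 0 s" using convex by (auto simp: convex_quad_def)
  then have "mat2 1 d 0 1 *v nu_quad a b c t d s
      = pt (slope s t b - slope s t a + (c + d) * slope a b t) (slope a b t - slope a b s)"
    using nu_quad_shear[OF pos, of c d d]
    by (simp add: nu_quad_tilt nu_quad_upright[OF pos] R2_eq_iff)
  then have snd: "nu_quad a b c t d s $ 2 = slope a b t - slope a b s"
    and "nu_quad a b c t d s $ 1 + d * nu_quad a b c t d s $ 2
      = slope s t b - slope s t a + (c + d) * slope a b t"
    by (auto simp: R2_eq_iff matrix_R2_nth)
  then show ?thesis unfolding snd by (simp add: R2_eq_iff snd algebra_simps)
qed

lemma slope_symmetric:
  assumes pos: "a > 0" "b > 0" "t > 0"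
  shows "slope a b t = slope b a t"
proof -
  define c where "c = b / t"
  have "c > 0" using pos by (simp add: c_def)
  have convex: "convex_quad a b c t 0 1"
    using pos by (intro convex_quad_upright) (auto simp: c_def)
  have mirror: "nu_quad b a (- x) t 0 1 $ 1 = - (nu_quad a b x t 0 1 $ 1)" for x
    using nu_quad_mirror[OF pos zero_less_one, of x 0] by (simp add: matrix_R2_nth)
  have "c * slope a b t = c * slope b a t"
    using mirror[of 0] mirror[of c] nu_quad_tilt[OF convex]
      nu_quad_tilt[OF convex_quad_mirror[OF convex, simplified]] by auto
  then show ?thesis using \<open>c > 0\<close> by simp
qed

lemma slope_homogeneous:
  assumes pos: "l > 0" "a > 0" "b > 0" "t > 0"
  shows "slope (l * a) (l * b) (t / l) = slope a b t / l"
proof -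
  define c where "c = b / t"
  have "c > 0" using pos by (simp add: c_def)
  have "l\<^sup>2 * c = l * b / (t / l)" by (simp add: c_def power2_eq_square)
  then have convex: "convex_quad (l * a) (l * b) (l\<^sup>2 * c) (t / l) 0 (1 / l)"
    "convex_quad a b c t 0 1"
    using pos \<open>c > 0\<close> by (auto simp: c_def[symmetric] intro!: convex_quad_upright)
  have scale: "nu_quad (l * a) (l * b) (l\<^sup>2 * x) (t / l) 0 (1 / l) $ 1
      = l * nu_quad a b x t 0 1 $ 1" for x
    using nu_quad_scale[OF pos(2-4) zero_less_one pos(1), of x 0] by (simp add: matrix_R2_nth)
  have "l\<^sup>2 * c * slope (l * a) (l * b) (t / l) = l * (c * slope a b t)"
    using scale[of 0] scale[of c] nu_quad_tilt[OF convex(1)] nu_quad_tilt[OF convex(2)]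
    by (simp add: algebra_simps)
  then show ?thesis using \<open>c > 0\<close> pos by (simp add: field_simps power2_eq_square)
qed

lemma slope_exchange:
  assumes pos: "a > 0" "b > 0" "s > 0" "t > 0"
  shows "2 * (slope s t b - slope s t a)
    = (slope t t b - slope t t a) + (slope s s b - slope s s a)"
proof -
  have "nu_quad a b 0 t 0 s - nu_quad a b 0 s 0 s = nu_quad a b 0 t 0 t - nu_quad a b 0 s 0 t"
    using pos by (intro nu_quad_exchange convex_quad_upright) auto
  then have "(slope s t b - slope s t a) - (slope s s b - slope s s a)
      = (slope t t b - slope t t a) - (slope t s b - slope t s a)"
    using pos by (simp add: nu_quad_upright R2_eq_iff)
  then show ?thesis using pos slope_symmetric[of t s] by simp
qed

lemma slope_triangle:
  assumes pos: "p > 0" "s > 0" "t > 0"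
  shows "slope 1 p (s / (p + 1)) - slope 1 p t + s / p * slope t (s / (p + 1)) p
    = slope 1 (p * t / (s + t)) s - slope 1 (p * t / (s + t)) t"
  using nu_quad_triangle(3)[OF pos] nu_quad_eq_slope[OF nu_quad_triangle(1)[OF pos]]
    nu_quad_eq_slope[OF nu_quad_triangle(2)[OF pos]] by (simp add: R2_eq_iff)

sublocale slope: triangle_equation slope
  by standard (rule slope_symmetric slope_homogeneous slope_exchange slope_triangle; assumption)+

lemma nu_quad_eq_scaled_quad_moment:
  obtains C where
    "\<And>a b c t d s. convex_quad a b c t d s \<Longrightarrow>
      nu (quad a b c t d s) = C *\<^sub>R scaled_quad_moment a b c t d s"
proof -
  obtain C where slope_eq: "\<And>a b t. a > 0 \<Longrightarrow> b > 0 \<Longrightarrow> t > 0 \<Longrightarrow> slope a b t = C * t\<^sup>2 * (a + b)"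
    using slope.kernel_quadratic by blast
  have "nu_quad a b c t d s = C *\<^sub>R scaled_quad_moment a b c t d s"
    if convex: "convex_quad a b c t d s" for a b c t d s
    using convex_quad_positive[OF convex] nu_quad_eq_slope[OF convex]
    by (simp add: scaled_quad_moment_def R2_eq_iff slope_eq algebra_simps)
  then show thesis using that by blast
qed

end

section \<open>Quadrilaterals with a diagonal through the origin\<close>

text \<open>Triangles are included, as quadrilaterals with a vertex on the opposite diagonal.\<close>
definition central_quads :: "R2 set set" where
  "central_quads = {convex hull {p, q, u, v} | p q u v. 0 \<in> open_segment p q \<and>
     (rot90 p \<bullet> u) * (rot90 p \<bullet> v) < 0 \<and> closed_segment p q \<inter> closed_segment u v \<noteq> {}}"

lemma central_quadsI:
  assumes "0 \<in> open_segment p q" "(rot90 p \<bullet> u) * (rot90 p \<bullet> v) < 0"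
    and "z \<in> closed_segment p q" "z \<in> closed_segment u v"
  shows "convex hull {p, q, u, v} \<in> central_quads"
  unfolding central_quads_def using assms by blast

lemma central_quads_subset_polygons_o: "central_quads \<subseteq> polygons_o"
  unfolding central_quads_def by (auto intro!: hull_in_polygons_o zero_in_interior_hull_diagonal)

lemma zero_in_open_segment_iff:
  fixes p q :: "'a::real_vector"
  shows "0 \<in> open_segment p q \<longleftrightarrow> p \<noteq> 0 \<and> (\<exists>l>0. q = - (l *\<^sub>R p))"
proof
  assume "0 \<in> open_segment p q"
  then obtain k where combination: "p \<noteq> q" "0 < k" "k < 1" "(1 - k) *\<^sub>R p + k *\<^sub>R q = 0"
    by (auto simp: in_segment)
  have "q = (1 / k) *\<^sub>R (k *\<^sub>R q)" using combination by simp
  also have "k *\<^sub>R q = - ((1 - k) *\<^sub>R p)" using combination(4) by (simp add: add_eq_0_iff)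
  finally have "q = - (((1 - k) / k) *\<^sub>R p)" by simp
  moreover have "(1 - k) / k > 0" using combination by simp
  ultimately show "p \<noteq> 0 \<and> (\<exists>l>0. q = - (l *\<^sub>R p))"
    using combination(1) by (metis minus_zero scaleR_zero_right)
next
  assume "p \<noteq> 0 \<and> (\<exists>l>0. q = - (l *\<^sub>R p))"
  then obtain l where l_props: "p \<noteq> 0" "l > 0" "q = - (l *\<^sub>R p)" by blast
  have "(1 - 1 / (1 + l)) *\<^sub>R p + (1 / (1 + l)) *\<^sub>R q = (1 - 1 / (1 + l) - l / (1 + l)) *\<^sub>R p"
    by (simp add: l_props(3) scaleR_left_diff_distrib)
  also have "1 - 1 / (1 + l) - l / (1 + l) = 0" using l_props(2) by (simp add: field_simps)
  finally have "0 = (1 - 1 / (1 + l)) *\<^sub>R p + (1 / (1 + l)) *\<^sub>R q" by simp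
  moreover have "p \<noteq> q"
  proof
    assume "p = q"
    have "(1 + l) *\<^sub>R p = p - q" by (simp add: l_props(3) scaleR_left_distrib)
    then show False using l_props(1,2) \<open>p = q\<close> by simp
  qed
  ultimately show "0 \<in> open_segment p q"
    using l_props(2) by (auto simp: in_segment intro!: exI[of _ "1 / (1 + l)"])
qed

lemma central_quadE:
  assumes "Q \<in> central_quads"
  obtains p l u v x where "Q = convex hull {p, - (l *\<^sub>R p), u, v}" "p \<noteq> 0" "l > 0"
    "rot90 p \<bullet> u > 0" "rot90 p \<bullet> v < 0" "- l \<le> x" "x \<le> 1" "x *\<^sub>R p \<in> closed_segment u v"
proof -
  obtain p q u v z where Q_eq: "Q = convex hull {p, q, u, v}" and "0 \<in> open_segment p q"
    and opposite: "(rot90 p \<bullet> u) * (rot90 p \<bullet> v) < 0"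
    and z_on_diagonals: "z \<in> closed_segment p q" "z \<in> closed_segment u v"
    using assms unfolding central_quads_def by blast
  then obtain l where l_pos: "p \<noteq> 0" "l > 0" and q_eq: "q = - (l *\<^sub>R p)"
    by (auto simp: zero_in_open_segment_iff)
  obtain k where k_range: "0 \<le> k" "k \<le> 1" and z_eq: "z = (1 - k) *\<^sub>R p + k *\<^sub>R q"
    using z_on_diagonals(1) by (auto simp: in_segment)
  define x where "x = 1 - k - k * l"
  have "z = x *\<^sub>R p" by (simp add: z_eq q_eq x_def scaleR_left_diff_distrib)
  moreover have "0 \<le> k * l" "k * l \<le> l" using k_range l_pos by (auto intro: mult_left_le_one_le)
  then have "- l \<le> x" "x \<le> 1" using k_range by (auto simp: x_def)
  moreover consider "rot90 p \<bullet> u > 0" "rot90 p \<bullet> v < 0" | "rot90 p \<bullet> v > 0" "rot90 p \<bullet> u < 0"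
    using opposite by (auto simp: mult_less_0_iff)
  ultimately show thesis
    using that[of p l u v x] that[of p l v u x] Q_eq q_eq l_pos z_on_diagonals(2)
    by cases (auto simp: insert_commute closed_segment_commute)
qed

lemma VL2_maps_horizontal_axis:
  assumes "p \<noteq> 0"
  obtains A where "A \<in> VL2" "det A = 1" "\<And>r. A *v pt r 0 = r *\<^sub>R p"
proof
  let ?A = "mat2 (p $ 1) (- p $ 2 / (p \<bullet> p)) (p $ 2) (p $ 1 / (p \<bullet> p))"
  show det: "det ?A = 1"
    using assms by (simp add: add_divide_distrib[symmetric] inner_R2[symmetric])
  then show "?A \<in> VL2" by (simp add: VL2_def)
  show "?A *v pt r 0 = r *\<^sub>R p" for r by (simp add: R2_eq_iff)
qed

lemma central_quad_is_image:
  assumes "Q \<in> central_quads"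
  obtains A a b c t d s where "A \<in> VL2" "convex_quad a b c t d s" "Q = (*v) A ` quad a b c t d s"
proof -
  obtain p l u v x where hull_eq: "Q = convex hull {p, - (l *\<^sub>R p), u, v}" and "p \<noteq> 0" "l > 0"
    and sides: "rot90 p \<bullet> u > 0" "rot90 p \<bullet> v < 0"
    and crossing: "- l \<le> x" "x \<le> 1" "x *\<^sub>R p \<in> closed_segment u v"
    using central_quadE[OF assms] by blast
  obtain A where "A \<in> VL2" and det: "det A = 1" and A_axis: "\<And>r. A *v pt r 0 = r *\<^sub>R p"
    using VL2_maps_horizontal_axis[OF \<open>p \<noteq> 0\<close>] by blast
  have bij: "inj ((*v) A)" "surj ((*v) A)"
    using VL2_invertible[OF \<open>A \<in> VL2\<close>]
    by (auto intro: inj_matrix_vector_mult simp: invertible_eq_bij bij_is_surj)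
  then obtain u' v' where preimage: "u = A *v u'" "v = A *v v'" by (metis surjD)
  define t s where "t = u' $ 2" and "s = - v' $ 2"
  have pos: "t > 0" "s > 0"
    using sides inner_rot90_mult[of A "pt 1 0" u'] inner_rot90_mult[of A "pt 1 0" v']
    by (auto simp: A_axis det preimage inner_R2 t_def s_def)
  define c d where "c = u' $ 1 / t" and "d = v' $ 1 / s"
  have vertices: "u' = pt (c * t) t" "v' = pt (d * s) (- s)"
    using pos by (auto simp: R2_eq_iff c_def d_def t_def s_def)
  have "{p, - (l *\<^sub>R p), u, v} = (*v) A ` {pt 1 0, pt (- l) 0, pt (c * t) t, pt (d * s) (- s)}"
    by (simp add: A_axis preimage vertices)
  then have Q_eq: "Q = (*v) A ` quad l 1 c t d s"
    by (simp add: hull_eq quad_def matrix_image_hull)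
  have "A *v pt x 0 \<in> closed_segment (A *v u') (A *v v')"
    using crossing(3) by (simp add: A_axis preimage)
  then have "pt x 0 \<in> closed_segment (pt (c * t) t) (pt (d * s) (- s))"
    using closed_segment_linear_image[of "(*v) A" u' v'] inj_image_mem_iff[OF bij(1)]
    by (simp add: vertices)
  then have "convex_quad l 1 c t d s"
    using \<open>l > 0\<close> pos crossing by (intro convex_quad_crossing) auto
  then show thesis using that[OF \<open>A \<in> VL2\<close> _ Q_eq] by blast
qed

lemma (in covariant_valuation) vanishes_on_central_quads:
  assumes zero: "\<And>a b c t d s. convex_quad a b c t d s \<Longrightarrow> nu (quad a b c t d s) = 0"
    and central: "Q \<in> central_quads"
  shows "nu Q = 0"
proof -
  obtain A a b c t d s where A_VL2: "A \<in> VL2" and convex: "convex_quad a b c t d s"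
    and Q_eq: "Q = (*v) A ` quad a b c t d s"
    using central_quad_is_image[OF central] by blast
  show ?thesis
    using covariant[OF A_VL2 quad_in_polygons_o[OF convex_quad_positive[OF convex]], of c d]
      zero[OF convex]
    by (simp add: Q_eq)
qed

section \<open>Reduction of polygons to central quadrilaterals\<close>

lemma supporting_functional_on_ray:
  fixes A :: "'a::euclidean_space set"
  assumes A_body: "compact A" "convex A" "0 \<in> interior A" and z_nonzero: "z \<noteq> 0"
  obtains r l where "r > 0" "r *\<^sub>R z \<in> A" "l \<bullet> (r *\<^sub>R z) = 1" "\<And>p. p \<in> A \<Longrightarrow> l \<bullet> p \<le> 1"
proof -
  obtain r where frontier: "r > 0" "r *\<^sub>R z \<in> frontier A"
    using ray_to_frontier[OF compact_imp_bounded[OF A_body(1)] A_body(3) z_nonzero] by (metis add_0)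
  define e where "e = r *\<^sub>R z"
  have on_boundary: "e \<in> A" "e \<notin> interior A"
    using frontier closure_closed[OF compact_imp_closed[OF A_body(1)]]
    by (auto simp: e_def frontier_def)
  have "rel_interior A = interior A"
    using A_body(3) by (intro rel_interior_nonempty_interior) auto
  then obtain a where support: "a \<noteq> 0" "\<And>y. y \<in> closure A \<Longrightarrow> a \<bullet> e \<le> a \<bullet> y"
    using supporting_hyperplane_relative_frontier[OF A_body(2), of e] on_boundary closure_subset
    by (metis subsetD)
  obtain y where "y \<in> A" "a \<bullet> y < 0"
    using A_body(3) support(1) zero_in_interior_iff[OF A_body(2)] by auto
  then have neg: "a \<bullet> e < 0"
    using support(2)[of y] closure_subset[of A] by (meson in_mono order_le_less_trans)
  show thesis
  proof
    show "r > 0" "r *\<^sub>R z \<in> A" using frontier on_boundary by (auto simp: e_def)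
    show "(1 / (a \<bullet> e)) *\<^sub>R a \<bullet> (r *\<^sub>R z) = 1" using neg by (simp add: e_def[symmetric])
    show "(1 / (a \<bullet> e)) *\<^sub>R a \<bullet> p \<le> 1" if "p \<in> A" for p
      using support(2)[of p] that neg closure_subset[of A] by (auto simp: divide_le_eq)
  qed
qed

lemma collinear_hyperplane_R2:
  fixes l :: R2
  assumes "l \<noteq> 0"
  shows "collinear {p. l \<bullet> p = b}"
  using aff_dim_hyperplane[OF assms, of b] by (simp add: collinear_aff_dim)

lemma polygon_edge_on_ray:
  fixes S :: "R2 set"
  assumes S_finite: "finite S" and int: "0 \<in> interior (convex hull S)" and z_nonzero: "z \<noteq> 0"
  obtains r x y l where "r > 0" "x \<in> S" "y \<in> S" "r *\<^sub>R z \<in> closed_segment x y"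
    "\<And>p. p \<in> convex hull S \<Longrightarrow> l \<bullet> p \<le> 1" "l \<bullet> x = 1" "l \<bullet> y = 1"
proof -
  let ?A = "convex hull S"
  have "compact ?A" using S_finite by (simp add: finite_imp_compact_convex_hull)
  then obtain r l where boundary: "r > 0" "r *\<^sub>R z \<in> ?A" "l \<bullet> (r *\<^sub>R z) = 1"
    and below: "\<And>p. p \<in> ?A \<Longrightarrow> l \<bullet> p \<le> 1"
    using supporting_functional_on_ray[OF _ convex_convex_hull int z_nonzero] by blast
  define T where "T = ?A \<inter> {p. l \<bullet> p = 1}"
  have "T face_of ?A"
    unfolding T_def by (intro face_of_Int_supporting_hyperplane_le below) auto
  then obtain S' where face_hull: "S' \<subseteq> S" "T = convex hull S'"
    using face_of_convex_hull_subset[OF finite_imp_compact[OF S_finite]] by blast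
  have "compact T" "convex T"
    using S_finite face_hull by (auto intro: finite_imp_compact_convex_hull finite_subset)
  moreover have "l \<noteq> 0" using boundary(3) by auto
  then have "collinear T"
    unfolding T_def by (intro collinear_subset[OF collinear_hyperplane_R2[of l 1]]) auto
  moreover have "r *\<^sub>R z \<in> T" using boundary by (simp add: T_def)
  ultimately obtain x y where T_eq: "T = closed_segment x y"
    using compact_convex_collinear_segment[of T] by blast
  then have "x extreme_point_of T" "y extreme_point_of T" by (auto simp: extreme_point_of_segment)
  then have "x \<in> S'" "y \<in> S'" unfolding face_hull(2) by (auto dest: extreme_point_of_convex_hull)
  moreover have "x \<in> T" "y \<in> T" using T_eq by auto
  then have "l \<bullet> x = 1" "l \<bullet> y = 1" by (auto simp: T_def)
  moreover have "r *\<^sub>R z \<in> closed_segment x y" using \<open>r *\<^sub>R z \<in> T\<close> T_eq by simp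
  ultimately show thesis
    using that[of r x y l] boundary(1) below face_hull(1) by blast
qed

lemma hyperplane_cuts_segment:
  fixes c b z l :: "'a::euclidean_space"
  assumes on_segment: "z \<in> closed_segment c b" and above: "l \<bullet> c \<ge> k" and below: "l \<bullet> b \<le> k"
  obtains f where "f \<in> closed_segment c b" "l \<bullet> f = k"
    "l \<bullet> z \<ge> k \<and> z \<in> closed_segment c f \<or> l \<bullet> z \<le> k \<and> z \<in> closed_segment f b"
proof -
  obtain f where crossing: "f \<in> closed_segment c b" "l \<bullet> f = k"
    using connected_ivt_hyperplane[of "closed_segment c b" b c l k] below above by auto
  have "closed_segment c f \<subseteq> {x. l \<bullet> x \<ge> k}" "closed_segment f b \<subseteq> {x. l \<bullet> x \<le> k}"
    by (intro closed_segment_subset convex_halfspace_ge convex_halfspace_le;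
        use crossing below above in simp)+
  then show thesis
    using that[OF crossing] on_segment Un_closed_segment[OF crossing(1)] by blast
qed

lemma convex_hull_insert_cut:
  fixes C :: "'a::euclidean_space set"
  assumes C_convex: "convex C" "C \<noteq> {}" and below: "\<And>x. x \<in> C \<Longrightarrow> l \<bullet> x \<le> k" and above: "l \<bullet> c \<ge> k"
    and slice: "\<And>x. x \<in> convex hull (insert c C) \<Longrightarrow> l \<bullet> x = k \<Longrightarrow> x \<in> C"
  shows "convex hull (insert c C) \<inter> {x. l \<bullet> x \<le> k} = C"
    and "convex hull (insert c C) \<inter> {x. l \<bullet> x \<ge> k} \<subseteq> convex hull (insert c (C \<inter> {x. l \<bullet> x = k}))"
proof -
  let ?H = "convex hull (insert c C)" and ?F = "C \<inter> {x. l \<bullet> x = k}"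
  have split: "z \<in> C \<or> l \<bullet> z \<ge> k \<and> z \<in> convex hull (insert c ?F)" if "z \<in> ?H" for z
  proof -
    obtain b where z_on_segment: "b \<in> C" "z \<in> closed_segment c b"
      using \<open>z \<in> ?H\<close> C_convex by (auto simp: convex_hull_insert_segments hull_same)
    obtain f where crossing: "f \<in> closed_segment c b" "l \<bullet> f = k"
      and side: "l \<bullet> z \<ge> k \<and> z \<in> closed_segment c f \<or> l \<bullet> z \<le> k \<and> z \<in> closed_segment f b"
      using hyperplane_cuts_segment[OF z_on_segment(2) above below[OF z_on_segment(1)]] by blast
    have "closed_segment c b \<subseteq> ?H"
      using z_on_segment(1) by (intro closed_segment_subset) (auto simp: hull_inc)
    then have "f \<in> ?F" using slice crossing by blast
    then have "closed_segment f b \<subseteq> C" "closed_segment c f \<subseteq> convex hull (insert c ?F)"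
      using z_on_segment(1) C_convex(1) by (intro closed_segment_subset; simp add: hull_inc)+
    then show ?thesis using side by blast
  qed
  have "C \<subseteq> ?H" by (auto simp: hull_inc)
  then show "?H \<inter> {x. l \<bullet> x \<le> k} = C"
    using split slice below by fastforce
  show "?H \<inter> {x. l \<bullet> x \<ge> k} \<subseteq> convex hull (insert c ?F)"
  proof
    fix z assume z_above: "z \<in> ?H \<inter> {x. l \<bullet> x \<ge> k}"
    have "z \<in> convex hull (insert c ?F)" if "z \<in> C"
      using that z_above below[OF that] by (intro hull_inc) auto
    then show "z \<in> convex hull (insert c ?F)" using split z_above by blast
  qed
qed

lemma convex_hull_insert_Un_Int:
  fixes A D :: "'a::euclidean_space set"
  assumes convex: "convex A" "convex D" and D_subset: "D \<noteq> {}" "D \<subseteq> A"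
    and below: "\<And>x. x \<in> A \<Longrightarrow> l \<bullet> x \<le> k" and above: "l \<bullet> c \<ge> k"
    and slice: "\<And>x. x \<in> convex hull (insert c A) \<Longrightarrow> l \<bullet> x = k \<Longrightarrow> x \<in> D"
  shows "A \<union> convex hull (insert c D) = convex hull (insert c A)"
    and "A \<inter> convex hull (insert c D) = D"
proof -
  let ?P = "convex hull (insert c A)" and ?B = "convex hull (insert c D)"
  have "?B \<subseteq> ?P" using D_subset(2) by (intro hull_mono) auto
  have "A \<subseteq> ?P" by (auto simp: hull_inc)
  have cut_P: "?P \<inter> {x. l \<bullet> x \<le> k} = A"
    "?P \<inter> {x. l \<bullet> x \<ge> k} \<subseteq> convex hull (insert c (A \<inter> {x. l \<bullet> x = k}))"
    using convex(1) D_subset below above slice by (intro convex_hull_insert_cut; blast)+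
  have "convex hull (insert c (A \<inter> {x. l \<bullet> x = k})) \<subseteq> ?B"
    using slice \<open>A \<subseteq> ?P\<close> by (intro hull_mono) auto
  then show "A \<union> ?B = ?P" using cut_P \<open>?B \<subseteq> ?P\<close> by fastforce
  have "?B \<inter> {x. l \<bullet> x \<le> k} = D"
    using convex(2) D_subset below above slice \<open>?B \<subseteq> ?P\<close> by (intro convex_hull_insert_cut(1)) blast+
  then show "A \<inter> ?B = D" using cut_P(1) \<open>?B \<subseteq> ?P\<close> by blast
qed

lemma extreme_points_bound_line:
  fixes P :: "'a::euclidean_space set"
  assumes "x extreme_point_of P" "y extreme_point_of P" "x \<noteq> y" "f \<in> P" "collinear {f, x, y}"
  shows "f \<in> closed_segment x y"
proof -
  have "x \<notin> open_segment y f" "y \<notin> open_segment f x"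
    using assms by (auto simp: extreme_point_of_def)
  then show ?thesis
    using assms(3,5) by (auto simp: collinear_between_cases between_mem_segment open_segment_def)
qed

lemma opposite_sides_of_edge_point:
  assumes between: "z \<in> open_segment x y" and edge: "l \<bullet> x = 1" "l \<bullet> y = 1"
  shows "(rot90 z \<bullet> x) * (rot90 z \<bullet> y) < 0"
proof -
  obtain k where k_range: "0 < k" "k < 1" and z_eq: "z = (1 - k) *\<^sub>R x + k *\<^sub>R y" and "x \<noteq> y"
    using between by (auto simp: in_segment)
  have "rot90 x \<bullet> y \<noteq> 0"
  proof
    assume "rot90 x \<bullet> y = 0"
    moreover have "x \<noteq> 0" using edge by auto
    ultimately obtain r where "y = r *\<^sub>R x" using rot90_orthogonal_imp_scaleR by blast
    then show False using edge \<open>x \<noteq> y\<close> by simp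
  qed
  moreover have "(rot90 z \<bullet> x) * (rot90 z \<bullet> y) = - (k * (1 - k)) * (rot90 x \<bullet> y)\<^sup>2"
    by (simp add: z_eq inner_R2 power2_eq_square algebra_simps)
  ultimately show ?thesis using k_range by (simp add: mult_pos_pos)
qed

lemma scaleR_in_segment:
  fixes p :: "'a::real_vector"
  assumes "- l \<le> r" "r \<le> 1" "l > 0"
  shows "r *\<^sub>R p \<in> closed_segment p (- (l *\<^sub>R p))"
proof -
  define k where "k = (1 - r) / (1 + l)"
  have k_props: "0 \<le> k" "k \<le> 1" "k * (1 + l) = 1 - r" using assms by (auto simp: k_def)
  then have "r = (1 - k) - k * l" by (simp add: algebra_simps)
  then have "r *\<^sub>R p = (1 - k) *\<^sub>R p + k *\<^sub>R (- (l *\<^sub>R p))"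
    by (metis diff_conv_add_uminus scaleR_left_diff_distrib scaleR_minus_right scaleR_scaleR)
  then show ?thesis using k_props by (auto simp: in_segment)
qed

lemma central_quad_across_edge:
  assumes "l > 0" "- l \<le> r" "r \<le> 1" "r \<noteq> 0"
    and edge: "r *\<^sub>R p \<in> open_segment x y" "m \<bullet> x = 1" "m \<bullet> y = 1"
  shows "convex hull {p, - (l *\<^sub>R p), x, y} \<in> central_quads"
proof (rule central_quadsI)
  have opposite: "(rot90 (r *\<^sub>R p) \<bullet> x) * (rot90 (r *\<^sub>R p) \<bullet> y) < 0"
    by (rule opposite_sides_of_edge_point[OF edge])
  also have "(rot90 (r *\<^sub>R p) \<bullet> x) * (rot90 (r *\<^sub>R p) \<bullet> y)
      = r\<^sup>2 * ((rot90 p \<bullet> x) * (rot90 p \<bullet> y))"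
    by (simp add: linear_scale[OF linear_rot90] power2_eq_square)
  finally show "(rot90 p \<bullet> x) * (rot90 p \<bullet> y) < 0"
    using \<open>r \<noteq> 0\<close> by (simp add: mult_less_0_iff)
  show "0 \<in> open_segment p (- (l *\<^sub>R p))"
    using opposite \<open>l > 0\<close> by (auto simp: zero_in_open_segment_iff inner_R2)
  show "r *\<^sub>R p \<in> closed_segment p (- (l *\<^sub>R p))"
    using assms by (intro scaleR_in_segment)
  show "r *\<^sub>R p \<in> closed_segment x y" using edge by (simp add: open_segment_def)
qed

lemma central_triangle_across_edge:
  assumes "h > 0" "r > 0" and edge: "r *\<^sub>R p \<in> open_segment x y" "m \<bullet> x = 1" "m \<bullet> y = 1"
  shows "convex hull {- (h *\<^sub>R p), x, y} \<in> central_quads"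
proof -
  define w where "w = - (h *\<^sub>R p)"
  have w_multiples: "(- (r / h)) *\<^sub>R w = r *\<^sub>R p" "- ((r / h) *\<^sub>R w) = r *\<^sub>R p"
    using assms(1) by (auto simp: w_def)
  have "r / h > 0" using assms(1,2) by simp
  then have "- (r / h) \<le> 1" by linarith
  then have "convex hull {w, - ((r / h) *\<^sub>R w), x, y} \<in> central_quads"
    using assms w_multiples by (intro central_quad_across_edge[of _ "- (r / h)"]) auto
  moreover have "convex hull {w, r *\<^sub>R p, x, y} = convex hull {w, x, y}"
    unfolding insert_commute[of w] using edge(1)
    by (intro convex_hull_insert_segment_point) (auto simp: open_segment_def)
  ultimately show ?thesis by (simp only: w_multiples flip: w_def)
qed

lemma extreme_point_not_in_hull_Diff:
  assumes "x extreme_point_of (convex hull S)"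
  shows "x \<notin> convex hull (S - {x})"
proof
  assume in_hull: "x \<in> convex hull (S - {x})"
  have "convex hull (S - {x}) \<subseteq> convex hull S" by (intro hull_mono) auto
  then have "x extreme_point_of (convex hull (S - {x}))"
    using assms in_hull unfolding extreme_point_of_def by blast
  then show False using extreme_point_of_convex_hull by blast
qed

lemma scaleR_in_convex_imp_less_1:
  assumes "convex A" "0 \<in> A" "c \<notin> A" "r *\<^sub>R c \<in> A"
  shows "r < 1"
proof (rule ccontr)
  assume "\<not> r < 1"
  then have "c \<in> closed_segment 0 (r *\<^sub>R c)"
    by (auto simp: in_segment intro!: exI[of _ "1 / r"])
  then show False using closed_segment_subset[OF assms(2,4,1)] assms(3) by blast
qed

lemma edge_facing_vertex:
  fixes S :: "R2 set"
  assumes "finite S" and extreme: "\<And>x. x \<in> S \<Longrightarrow> x extreme_point_of (convex hull S)"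
    and vertex: "c \<in> S" and int: "0 \<in> interior (convex hull (S - {c}))"
  obtains r x y l where "0 < r" "r < 1" "x \<in> S - {c}" "y \<in> S - {c}" "r *\<^sub>R c \<in> open_segment x y"
    "l \<bullet> x = 1" "l \<bullet> y = 1" "\<And>p. p \<in> convex hull (S - {c}) \<Longrightarrow> l \<bullet> p \<le> 1"
    "\<And>p. p \<in> convex hull S \<Longrightarrow> l \<bullet> p = 1 \<Longrightarrow> p \<in> closed_segment x y"
proof -
  let ?P = "convex hull S" and ?A = "convex hull (S - {c})"
  have "0 \<in> ?A" using int interior_subset by blast
  have "c \<notin> ?A" using extreme_point_not_in_hull_Diff extreme vertex by blast
  then have "c \<noteq> 0" using \<open>0 \<in> ?A\<close> by auto
  obtain r x y l where "r > 0" and endpoints: "x \<in> S - {c}" "y \<in> S - {c}"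
    and meets_edge: "r *\<^sub>R c \<in> closed_segment x y" and below: "\<And>p. p \<in> ?A \<Longrightarrow> l \<bullet> p \<le> 1"
    and edge: "l \<bullet> x = 1" "l \<bullet> y = 1"
    using polygon_edge_on_ray[OF _ int \<open>c \<noteq> 0\<close>] \<open>finite S\<close> by (metis finite_Diff)
  have "r *\<^sub>R c \<in> ?A"
    using meets_edge closed_segment_subset[of x ?A y] endpoints by (auto simp: hull_inc)
  then have "r < 1"
    using scaleR_in_convex_imp_less_1[OF convex_convex_hull \<open>0 \<in> ?A\<close> \<open>c \<notin> ?A\<close>] by blast
  then have "r *\<^sub>R c \<in> open_segment 0 c"
    using \<open>r > 0\<close> \<open>c \<noteq> 0\<close> by (auto simp: in_segment intro!: exI[of _ r])
  moreover have "0 \<in> ?P" using \<open>0 \<in> ?A\<close> hull_mono[of "S - {c}" S] by blast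
  ultimately have "\<not> r *\<^sub>R c extreme_point_of ?P"
    using hull_inc[OF vertex] unfolding extreme_point_of_def by blast
  then have meets_open_edge: "r *\<^sub>R c \<in> open_segment x y"
    using meets_edge extreme endpoints by (auto simp: open_segment_def)
  have "f \<in> closed_segment x y" if "f \<in> ?P" "l \<bullet> f = 1" for f
  proof (rule extreme_points_bound_line)
    show "x extreme_point_of ?P" "y extreme_point_of ?P" "f \<in> ?P"
      using extreme endpoints that by auto
    show "x \<noteq> y" using meets_open_edge by auto
    have "l \<noteq> 0" using edge by auto
    then show "collinear {f, x, y}"
      using that edge by (intro collinear_subset[OF collinear_hyperplane_R2[of l 1]]) auto
  qed
  then show thesis
    using that[of r x y l] \<open>r > 0\<close> \<open>r < 1\<close> endpoints meets_open_edge edge below by blast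
qed

lemma contains_negative_multiple:
  fixes A :: "'a::real_normed_vector set"
  assumes "0 \<in> interior A" "c \<noteq> 0"
  obtains h where "h > 0" "- (h *\<^sub>R c) \<in> A"
proof -
  obtain d where ball: "d > 0" "cball 0 d \<subseteq> A" using assms(1) by (meson mem_interior_cball)
  then have "- ((d / norm c) *\<^sub>R c) \<in> A" using assms(2) by (auto simp: subset_iff)
  then show thesis using that[of "d / norm c"] ball assms(2) by simp
qed

text \<open>\<open>B\<close> is spanned by \<open>c\<close>, the edge of the hull of the other vertices that faces \<open>c\<close>, and a
  point opposite to \<open>c\<close>; \<open>D\<close> is the triangle that remains of it without \<open>c\<close>.\<close>
lemma cut_off_vertex:
  fixes S :: "R2 set"
  assumes S_vertices: "finite S" "\<And>x. x \<in> S \<Longrightarrow> x extreme_point_of (convex hull S)"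
    and vertex: "c \<in> S"
    and int: "0 \<in> interior (convex hull (S - {c}))"
  obtains B D where "B \<in> central_quads" "D \<in> central_quads"
    "convex hull (S - {c}) \<union> B = convex hull S" "convex hull (S - {c}) \<inter> B = D"
proof -
  let ?A = "convex hull (S - {c})"
  obtain r x y l where r_range: "0 < r" "r < 1" and endpoints: "x \<in> S - {c}" "y \<in> S - {c}"
    and meets_edge: "r *\<^sub>R c \<in> open_segment x y" and edge: "l \<bullet> x = 1" "l \<bullet> y = 1"
    and below: "\<And>p. p \<in> ?A \<Longrightarrow> l \<bullet> p \<le> 1"
    and slice: "\<And>p. p \<in> convex hull S \<Longrightarrow> l \<bullet> p = 1 \<Longrightarrow> p \<in> closed_segment x y"
    using edge_facing_vertex[OF S_vertices vertex int] by blast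
  have "l \<bullet> (r *\<^sub>R c) = 1"
    using meets_edge closed_segment_subset[of x "{p. l \<bullet> p = 1}" y] edge
    by (auto simp: open_segment_def convex_hyperplane)
  then have "l \<bullet> c = 1 / r" using r_range by (simp add: field_simps)
  then have above: "l \<bullet> c \<ge> 1" using r_range by simp
  then have "c \<noteq> 0" by auto
  obtain h where opposite: "h > 0" "- (h *\<^sub>R c) \<in> ?A"
    using contains_negative_multiple[OF int \<open>c \<noteq> 0\<close>] by blast
  define w D where "w = - (h *\<^sub>R c)" and "D = convex hull {w, x, y}"
  have "D \<subseteq> ?A"
    unfolding D_def using endpoints opposite by (intro hull_minimal) (auto simp: w_def hull_inc)
  have "closed_segment x y \<subseteq> D"
    unfolding D_def by (intro closed_segment_subset) (auto simp: hull_inc)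
  have P_eq: "convex hull S = convex hull (insert c ?A)"
    using vertex by (metis hull_insert insert_Diff)
  have decomposition: "?A \<union> convex hull (insert c D) = convex hull (insert c ?A)"
    "?A \<inter> convex hull (insert c D) = D"
    using slice below above \<open>D \<subseteq> ?A\<close> \<open>closed_segment x y \<subseteq> D\<close> unfolding P_eq
    by (intro convex_hull_insert_Un_Int[where l = l and k = 1]; auto simp: D_def)+
  have "convex hull (insert c D) = convex hull {c, - (h *\<^sub>R c), x, y}"
    unfolding D_def w_def by (rule hull_insert[symmetric])
  also have "\<dots> \<in> central_quads"
    using opposite r_range meets_edge edge by (intro central_quad_across_edge) auto
  finally have "convex hull (insert c D) \<in> central_quads" .
  moreover have "D \<in> central_quads"
    unfolding D_def w_def using opposite r_range meets_edge edge
    by (intro central_triangle_across_edge) auto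
  ultimately show thesis using that decomposition P_eq by metis
qed

lemma central_quad_on_extreme_diagonal:
  fixes P :: "R2 set"
  assumes P_extreme: "convex P" "p extreme_point_of P" "q extreme_point_of P"
    and zero_between: "0 \<in> open_segment p q"
    and sides: "u \<in> P" "v \<in> P" "rot90 p \<bullet> u < 0" "rot90 p \<bullet> v > 0"
  shows "convex hull {p, q, u, v} \<in> central_quads"
proof -
  have "connected (closed_segment u v)" by simp
  then obtain z where crossing: "z \<in> closed_segment u v" "rot90 p \<bullet> z = 0"
    using connected_ivt_hyperplane[of "closed_segment u v" u v "rot90 p" 0] sides by auto
  have "z \<in> closed_segment p q"
  proof (rule extreme_points_bound_line[OF P_extreme(2,3)])
    show "p \<noteq> q" using zero_between by auto
    show "z \<in> P" using crossing(1) closed_segment_subset[OF sides(1,2) P_extreme(1)] by blast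
    obtain l where "p \<noteq> 0" "q = - (l *\<^sub>R p)"
      using zero_between by (auto simp: zero_in_open_segment_iff)
    then show "collinear {z, p, q}"
      using crossing(2) by (intro collinear_subset[OF collinear_hyperplane_R2[of "rot90 p" 0]]) auto
  qed
  moreover have "(rot90 p \<bullet> u) * (rot90 p \<bullet> v) < 0" using sides by (simp add: mult_neg_pos)
  ultimately show ?thesis using central_quadsI[OF zero_between] crossing(1) by blast
qed

lemma central_quad_of_vertices:
  fixes S :: "R2 set"
  assumes S_vertices: "finite S" "\<And>x. x \<in> S \<Longrightarrow> x extreme_point_of (convex hull S)"
    and int: "0 \<in> interior (convex hull S)"
  obtains T where "T \<subseteq> S" "convex hull T \<in> central_quads"
proof -
  have "0 \<in> convex hull S" using int interior_subset by blast
  then obtain p where p_vertex: "p \<in> S" by fastforce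
  have "p \<noteq> 0" using S_vertices(2)[OF p_vertex] int extreme_point_not_in_interior by blast
  then obtain r x y l where "r > 0" and endpoints: "x \<in> S" "y \<in> S"
    and meets_edge: "r *\<^sub>R (- p) \<in> closed_segment x y" and edge: "l \<bullet> x = 1" "l \<bullet> y = 1"
    using polygon_edge_on_ray[OF S_vertices(1) int, of "- p"] by (metis neg_equal_0_iff_equal)
  show thesis
  proof (cases "r *\<^sub>R (- p) \<in> {x, y}")
    case True
    define q where "q = r *\<^sub>R (- p)"
    have "q \<in> S" using True endpoints by (auto simp: q_def)
    have "0 \<in> open_segment p q"
      using \<open>r > 0\<close> \<open>p \<noteq> 0\<close> by (auto simp: q_def zero_in_open_segment_iff)
    obtain u v where sides: "u \<in> S" "v \<in> S" "rot90 p \<bullet> u < 0" "- rot90 p \<bullet> v < 0"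
      using int \<open>p \<noteq> 0\<close> unfolding zero_in_interior_hull_iff
      by (metis neg_equal_0_iff_equal rot90_eq_0_iff)
    then have "convex hull {p, q, u, v} \<in> central_quads"
      using S_vertices(2) p_vertex \<open>q \<in> S\<close> \<open>0 \<in> open_segment p q\<close>
      by (intro central_quad_on_extreme_diagonal[of "convex hull S"]) (auto simp: hull_inc)
    then show thesis using that[of "{p, q, u, v}"] p_vertex \<open>q \<in> S\<close> sides by blast
  next
    case False
    then have "r *\<^sub>R (- p) \<in> open_segment x y" using meets_edge by (simp add: open_segment_def)
    then have "convex hull {- (1 *\<^sub>R (- p)), x, y} \<in> central_quads"
      using \<open>r > 0\<close> edge by (intro central_triangle_across_edge) auto
    then show thesis using that[of "{p, x, y}"] p_vertex endpoints by simp
  qed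
qed

lemma removable_vertex_or_central:
  fixes S :: "R2 set"
  assumes S_vertices: "finite S" "\<And>x. x \<in> S \<Longrightarrow> x extreme_point_of (convex hull S)"
    and int: "0 \<in> interior (convex hull S)"
  obtains (central) "convex hull S \<in> central_quads"
    | (removable) c where "c \<in> S" "0 \<in> interior (convex hull (S - {c}))"
proof -
  obtain T where T_central: "T \<subseteq> S" "convex hull T \<in> central_quads"
    using central_quad_of_vertices[OF S_vertices int] by blast
  show thesis
  proof (cases "T = S")
    case False
    then obtain c where c_outside: "c \<in> S" "c \<notin> T" using T_central by blast
    then have "convex hull T \<subseteq> convex hull (S - {c})" using T_central by (intro hull_mono) auto
    moreover have "0 \<in> interior (convex hull T)"
      using T_central(2) central_quads_subset_polygons_o polygons_oD(3) by blast
    ultimately show thesis using removable[OF c_outside(1)] interior_mono by blast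
  qed (use T_central central in simp)
qed

lemma valuation_zero_insert_vertex:
  fixes nu :: "R2 set \<Rightarrow> 'b::ab_group_add"
  assumes val: "is_valuation_on polygons_o nu" and zero: "\<And>Q. Q \<in> central_quads \<Longrightarrow> nu Q = 0"
    and S_vertices: "finite S" "\<And>x. x \<in> S \<Longrightarrow> x extreme_point_of (convex hull S)" and vertex: "c \<in> S"
    and int: "0 \<in> interior (convex hull (S - {c}))" and rest: "nu (convex hull (S - {c})) = 0"
  shows "nu (convex hull S) = 0"
proof -
  let ?A = "convex hull (S - {c})"
  obtain B D where parts: "B \<in> central_quads" "D \<in> central_quads"
    "?A \<union> B = convex hull S" "?A \<inter> B = D"
    using cut_off_vertex[OF S_vertices vertex int] by blast
  have "0 \<in> interior (convex hull S)"
    using int interior_mono[OF hull_mono[of "S - {c}" S]] by blast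
  then have "?A \<in> polygons_o" "convex hull S \<in> polygons_o" "B \<in> polygons_o" "D \<in> polygons_o"
    using S_vertices(1) int parts(1,2) central_quads_subset_polygons_o
    by (auto intro: hull_in_polygons_o)
  then have "nu (convex hull S) + nu D = nu ?A + nu B"
    using val[unfolded is_valuation_on_def, rule_format, of ?A B] parts(3,4) by simp
  then show ?thesis using zero parts(1,2) rest by simp
qed

lemma valuation_zero_on_central_quads_imp_zero:
  fixes nu :: "R2 set \<Rightarrow> 'b::ab_group_add"
  assumes val: "is_valuation_on polygons_o nu" and zero: "\<And>Q. Q \<in> central_quads \<Longrightarrow> nu Q = 0"
    and polygon: "P \<in> polygons_o"
  shows "nu P = 0"
proof -
  have "nu (convex hull S) = 0" if "finite S" "0 \<in> interior (convex hull S)" for S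
    using that
  proof (induction "card S" arbitrary: S rule: less_induct)
    case less
    define V where "V = {x. x extreme_point_of (convex hull S)}"
    have "V \<subseteq> S" unfolding V_def by (rule extreme_points_of_convex_hull)
    then have "finite V" using less.prems(1) finite_subset by blast
    have hull: "convex hull S = convex hull V"
      unfolding V_def by (rule Krein_Milman_polytope[OF less.prems(1)])
    have extreme: "x extreme_point_of (convex hull V)" if "x \<in> V" for x
      using that unfolding hull[symmetric] by (simp add: V_def)
    have "0 \<in> interior (convex hull V)" using less.prems(2) hull by simp
    then consider (central) "convex hull V \<in> central_quads"
      | (removable) c where "c \<in> V" "0 \<in> interior (convex hull (V - {c}))"
      using removable_vertex_or_central[OF \<open>finite V\<close> extreme] by blast
    then show ?case
    proof cases
      case (removable c)
      have "card (V - {c}) < card S"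
        using removable(1) \<open>V \<subseteq> S\<close> less.prems(1) by (intro psubset_card_mono) auto
      then have "nu (convex hull (V - {c})) = 0"
        using less.hyps[of "V - {c}"] \<open>finite V\<close> removable(2) by simp
      then show ?thesis
        using valuation_zero_insert_vertex[OF val zero \<open>finite V\<close> extreme removable] hull by simp
    qed (simp add: zero hull)
  qed
  then show ?thesis using polygon by (auto simp: polygons_o_def)
qed

section \<open>The moment vector\<close>

lemma absolutely_integrable_ident_compact:
  fixes S :: "'a::euclidean_space set"
  assumes "compact S"
  shows "(\<lambda>x. x) absolutely_integrable_on S"
proof -
  have "integrable lborel (\<lambda>x. indicator S x *\<^sub>R x)"
    using assms by (intro borel_integrable_compact) auto
  then show ?thesis
    unfolding set_integrable_def by (intro integrable_completion[THEN iffD2]) auto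
qed

lemma integrable_ident_compact:
  fixes S :: "'a::euclidean_space set"
  shows "compact S \<Longrightarrow> (\<lambda>x. x) integrable_on S"
  using absolutely_integrable_ident_compact set_lebesgue_integral_eq_integral(1) by blast

lemma moment_Un_Int:
  assumes "compact K" "compact L"
  shows "moment (K \<union> L) + moment (K \<inter> L) = moment K + moment L"
proof -
  let ?restr = "\<lambda>S x. if x \<in> S then x else (0::R2)"
  have add: "moment S + moment T = integral UNIV (\<lambda>x. ?restr S x + ?restr T x)"
    if "compact S" "compact T" for S T
    using integral_add[of "?restr S" UNIV "?restr T"] integrable_ident_compact[OF that(1)]
      integrable_ident_compact[OF that(2)]
    by (simp add: moment_def integral_restrict_UNIV integrable_restrict_UNIV)
  have "(\<lambda>x. ?restr (K \<union> L) x + ?restr (K \<inter> L) x) = (\<lambda>x. ?restr K x + ?restr L x)" by auto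
  then show ?thesis using assms by (simp add: add compact_Un compact_Int)
qed

lemma moment_linear_image:
  assumes "compact P"
  shows "moment ((*v) A ` P) = \<bar>det A\<bar> *\<^sub>R (A *v moment P)"
proof -
  have "compact ((*v) A ` P)"
    using assms by (intro compact_continuous_image) (auto intro: continuous_intros)
  then have "moment ((*v) A ` P) = \<bar>det (matrix ((*v) A))\<bar> *\<^sub>R integral P ((\<lambda>x. x) \<circ> (*v) A)"
    unfolding moment_def
    by (intro integral_change_of_variables_linear absolutely_integrable_ident_compact disjI1) auto
  moreover have "integral P ((*v) A \<circ> (\<lambda>x. x)) = A *v integral P (\<lambda>x. x)"
    using integrable_ident_compact[OF assms]
    by (intro integral_linear matrix_vector_mul_bounded_linear)
  ultimately show ?thesis by (simp add: moment_def o_def)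
qed

lemma norm_moment_le:
  assumes "compact P" "P \<subseteq> cball 0 R"
  shows "norm (moment P) \<le> integral (cball 0 R) (\<lambda>x::R2. R)"
proof -
  let ?restr = "\<lambda>x. if x \<in> P then x else (0::R2)"
  have P_Int: "P \<inter> cball 0 R = P" using assms(2) by auto
  have "moment P = integral (cball 0 R) ?restr"
    using integral_restrict_Int[of "cball 0 R" P "\<lambda>x. x"] P_Int by (simp add: moment_def)
  also have "norm \<dots> \<le> integral (cball 0 R) (\<lambda>x::R2. R)"
  proof (rule integral_norm_bound_integral)
    show "?restr integrable_on cball 0 R"
      using integrable_ident_compact[OF assms(1)]
        integrable_restrict_Int[of P "\<lambda>x. x" "cball 0 R"] P_Int
      by simp
    show "norm (?restr x) \<le> R" if "x \<in> cball 0 R" for x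
      using that order_trans[OF norm_ge_zero, of x R] by auto
  qed (simp add: integrable_on_const)
  finally show ?thesis .
qed

lemma norm_pt_le: "norm (pt x y) \<le> \<bar>x\<bar> + \<bar>y\<bar>"
  using norm_le_l1_cart[of "pt x y"] by (simp add: sum_2)

lemma quad_subset_cball:
  assumes "a > 0" "b > 0" "t > 0" "s > 0" "\<bar>c\<bar> \<le> 1"
  shows "quad a b c t 0 s \<subseteq> cball 0 (a + b + 2 * t + s)"
  unfolding quad_def
proof (rule hull_minimal)
  have "\<bar>c * t\<bar> \<le> t" using assms by (simp add: abs_mult mult_left_le_one_le)
  then show "{pt b 0, pt (- a) 0, pt (c * t) t, pt (0 * s) (- s)} \<subseteq> cball 0 (a + b + 2 * t + s)"
    using assms norm_pt_le[of b 0] norm_pt_le[of "- a" 0] norm_pt_le[of "c * t" t]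
      norm_pt_le[of 0 "- s"]
    by auto
qed simp

interpretation moment: regular_covariant_valuation moment
proof
  show "is_valuation_on polygons_o moment"
    using moment_Un_Int polygons_oD(1) by (auto simp: is_valuation_on_def)
  show "moment ((*v) A ` P) = A *v moment P" if "A \<in> VL2" "P \<in> polygons_o" for A P
    using moment_linear_image[OF polygons_oD(1)[OF that(2)], of A] that(1) by (auto simp: VL2_def)
  fix a b t s :: real assume pos: "a > 0" "b > 0" "t > 0" "s > 0"
  define R where "R = a + b + 2 * t + s"
  have "norm (moment (quad a b c t 0 s)) \<le> integral (cball 0 R) (\<lambda>x::R2. R)" if "\<bar>c\<bar> \<le> 1" for c
    unfolding R_def
    using quad_subset_cball[OF pos that] polygons_oD(1)[OF quad_in_polygons_o[OF pos]]
    by (intro norm_moment_le)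
  then have "bounded ((\<lambda>c. moment (quad a b c t 0 s)) ` {-1..1})"
    unfolding bounded_iff by (intro exI[of _ "integral (cball 0 R) (\<lambda>x::R2. R)"]) auto
  moreover have "\<not> negligible {-1..1::real}" by (simp add: negligible_iff_measure)
  ultimately show "bounded_on_nonnegligible {-1..1} (\<lambda>c. moment (quad a b c t 0 s))"
    unfolding bounded_on_nonnegligible_def by (intro bexI[of _ "{-1..1}"]) auto
qed

lemma cbox_in_polygons_o:
  assumes "0 \<in> box a (b::R2)"
  shows "cbox a b \<in> polygons_o"
proof -
  obtain S where "finite S" "cbox a b = convex hull S"
    using polytope_interval[of a b] by (auto simp: polytope_def)
  moreover have "0 \<in> interior (cbox a b)" using assms by (simp add: interior_cbox)
  ultimately show ?thesis unfolding polygons_o_def by blast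
qed

lemma moment_nonzero: "\<exists>P\<in>polygons_o. moment P \<noteq> 0"
proof (rule ccontr)
  assume "\<not> ?thesis"
  then have zero: "moment P = 0" if "P \<in> polygons_o" for P using that by blast
  define inner outer strip where "inner = cbox (pt (- 1) (- 1)) (pt 1 1)"
    and "outer = cbox (pt (- 1) (- 1)) (pt 2 1)" and "strip = cbox (pt 1 (- 1)) (pt 2 1)"
  have "inner \<in> polygons_o" "outer \<in> polygons_o"
    unfolding inner_def outer_def by (auto intro!: cbox_in_polygons_o simp: mem_box_cart forall_2)
  moreover have "inner \<union> strip = outer" "inner \<inter> strip \<subseteq> {x. pt 1 0 \<bullet> x = 1}"
    by (auto simp: inner_def outer_def strip_def mem_box_cart forall_2 inner_R2)
  moreover have "negligible {x. pt 1 0 \<bullet> x = 1}" by (simp add: negligible_hyperplane)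
  ultimately have "negligible (inner \<inter> strip)" "moment inner = 0" "moment (inner \<union> strip) = 0"
    using zero negligible_subset by auto
  then have "moment strip = 0"
    using integral_Un[of "\<lambda>x. x" inner strip]
    by (simp add: moment_def integrable_ident_compact inner_def strip_def)
  moreover have "moment strip $ 1 = integral strip (\<lambda>x. x $ 1)"
    by (simp add: moment_def integral_component_eq_cart integrable_ident_compact strip_def)
  moreover have "integral strip (\<lambda>x. 1::real) \<le> integral strip (\<lambda>x. x $ 1)"
    unfolding strip_def
    by (intro integral_le integrable_continuous continuous_intros)
      (auto simp: mem_box_cart forall_2)
  moreover have "integral strip (\<lambda>x. 1::real) > 0"
  proof -
    have "\<forall>i\<in>Basis. pt 1 (- 1) \<bullet> i < pt 2 1 \<bullet> i"
      by (auto simp: Basis_vec_def inner_axis forall_2 exhaust_2)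
    then show ?thesis by (simp add: strip_def content_pos_lt_eq)
  qed
  ultimately show False by simp
qed

lemma covariant_valuation_diff_scaleR:
  assumes "covariant_valuation f" "covariant_valuation g"
  shows "covariant_valuation (\<lambda>P. f P - k *\<^sub>R g P)"
proof
  interpret f: covariant_valuation f by fact
  interpret g: covariant_valuation g by fact
  show "is_valuation_on polygons_o (\<lambda>P. f P - k *\<^sub>R g P)"
    unfolding is_valuation_on_def
  proof (intro allI impI)
    fix K L :: "R2 set"
    assume "K \<in> polygons_o \<and> L \<in> polygons_o \<and> K \<union> L \<in> polygons_o \<and> K \<inter> L \<in> polygons_o"
    then have "f (K \<union> L) + f (K \<inter> L) = f K + f L" "g (K \<union> L) + g (K \<inter> L) = g K + g L"
      using f.valuation g.valuation by (auto simp: is_valuation_on_def)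
    then have "(f (K \<union> L) + f (K \<inter> L)) - k *\<^sub>R (g (K \<union> L) + g (K \<inter> L))
        = (f K + f L) - k *\<^sub>R (g K + g L)"
      by simp
    then show "(f (K \<union> L) - k *\<^sub>R g (K \<union> L)) + (f (K \<inter> L) - k *\<^sub>R g (K \<inter> L))
        = (f K - k *\<^sub>R g K) + (f L - k *\<^sub>R g L)"
      by (simp add: scaleR_add_right algebra_simps)
  qed
  show "f ((*v) A ` P) - k *\<^sub>R g ((*v) A ` P) = A *v (f P - k *\<^sub>R g P)"
    if "A \<in> VL2" "P \<in> polygons_o" for A P
    using f.covariant[OF that] g.covariant[OF that]
    by (simp add: matrix_vector_mult_diff_distrib matrix_vector_mult_scaleR)
qed

lemma (in covariant_valuation) zero_on_quads_imp_zero: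
  assumes "\<And>a b c t d s. convex_quad a b c t d s \<Longrightarrow> nu (quad a b c t d s) = 0" "P \<in> polygons_o"
  shows "nu P = 0"
  using valuation_zero_on_central_quads_imp_zero[OF valuation] vanishes_on_central_quads assms
  by blast

lemma regular_covariant_valuation_eq_moment:
  assumes "regular_covariant_valuation nu"
  obtains k where "\<And>P. P \<in> polygons_o \<Longrightarrow> nu P = k *\<^sub>R moment P"
proof -
  interpret nu: regular_covariant_valuation nu by fact
  obtain C where nu_eq:
    "\<And>a b c t d s. convex_quad a b c t d s \<Longrightarrow>
      nu (quad a b c t d s) = C *\<^sub>R scaled_quad_moment a b c t d s"
    using nu.nu_quad_eq_scaled_quad_moment by blast
  obtain M where moment_eq:
    "\<And>a b c t d s. convex_quad a b c t d s \<Longrightarrow>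
      moment (quad a b c t d s) = M *\<^sub>R scaled_quad_moment a b c t d s"
    using moment.nu_quad_eq_scaled_quad_moment by blast
  have "M \<noteq> 0"
  proof
    assume "M = 0"
    then show False using moment.zero_on_quads_imp_zero moment_eq moment_nonzero by fastforce
  qed
  interpret diff: covariant_valuation "\<lambda>P. nu P - (C / M) *\<^sub>R moment P"
    by (intro covariant_valuation_diff_scaleR nu.covariant_valuation_axioms
        moment.covariant_valuation_axioms)
  have "nu P - (C / M) *\<^sub>R moment P = 0" if "P \<in> polygons_o" for P
    by (rule diff.zero_on_quads_imp_zero[OF _ that]) (use nu_eq moment_eq \<open>M \<noteq> 0\<close> in simp)
  then show thesis using that[of "C / M"] by simp
qed

section \<open>Polarity\<close>

lemma polar_convex_hull: "polar (convex hull S) = (\<Inter>x\<in>S. {y. x \<bullet> y \<le> 1})"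
proof (intro equalityI subsetI)
  fix y assume "y \<in> (\<Inter>x\<in>S. {y. x \<bullet> y \<le> 1})"
  then have "convex hull S \<subseteq> {x. y \<bullet> x \<le> 1}"
    by (intro hull_minimal convex_halfspace_le) (auto simp: inner_commute)
  then show "y \<in> polar (convex hull S)" by (auto simp: polar_def)
qed (auto simp: polar_def inner_commute hull_inc)

lemma polar_antimono: "K \<subseteq> L \<Longrightarrow> polar L \<subseteq> polar K"
  by (auto simp: polar_def)

lemma polar_cball:
  assumes "e > 0"
  shows "polar (cball 0 e) = cball 0 (1 / e)"
proof (intro equalityI subsetI)
  fix y :: R2 assume y_polar: "y \<in> polar (cball 0 e)"
  show "y \<in> cball 0 (1 / e)"
  proof (cases "y = 0")
    case False
    then have "(e / norm y) *\<^sub>R y \<in> cball 0 e" using assms by simp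
    then have "y \<bullet> ((e / norm y) *\<^sub>R y) \<le> 1" using y_polar unfolding polar_def by blast
    then show ?thesis using False assms
      by (simp add: power2_norm_eq_inner[symmetric] power2_eq_square field_simps)
  qed (use assms in simp)
next
  fix y :: R2 assume "y \<in> cball 0 (1 / e)"
  then have "norm y * e \<le> 1" using assms by (simp add: field_simps)
  moreover have "y \<bullet> x \<le> norm y * e" if "x \<in> cball 0 e" for x
    using that norm_cauchy_schwarz[of y x] mult_left_mono[of "norm x" e "norm y"] by simp
  ultimately show "y \<in> polar (cball 0 e)" by (force simp: polar_def)
qed

lemma polar_in_polygons_o:
  assumes polygon: "P \<in> polygons_o"
  shows "polar P \<in> polygons_o"
proof -
  obtain S where P_hull: "finite S" "P = convex hull S"
    using polygon by (auto simp: polygons_o_def)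
  obtain e where inner_ball: "e > 0" "cball 0 e \<subseteq> P"
    using polygons_oD(3)[OF polygon] by (meson mem_interior_cball)
  obtain R where outer_ball: "R > 0" "P \<subseteq> cball 0 R"
    using compact_imp_bounded[OF polygons_oD(1)[OF polygon]] by (auto simp: bounded_pos subset_iff)
  have "bounded (polar P)"
    using polar_antimono[OF inner_ball(2)] polar_cball[OF inner_ball(1)]
      bounded_cball bounded_subset by metis
  moreover have "polyhedron (polar P)"
    unfolding P_hull(2) polar_convex_hull using P_hull(1)
    by (intro polyhedron_Inter) (auto intro: polyhedron_halfspace_le)
  ultimately have "polytope (polar P)" by (simp add: polytope_eq_bounded_polyhedron)
  then obtain T where "finite T" "polar P = convex hull T" by (auto simp: polytope_def)
  moreover have "cball 0 (1 / R) \<subseteq> polar P"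
    using polar_antimono[OF outer_ball(2)] polar_cball[OF outer_ball(1)] by simp
  then have "0 \<in> interior (polar P)"
    using outer_ball(1) by (meson divide_pos_pos mem_interior_cball zero_less_one)
  ultimately show ?thesis by (auto simp: polygons_o_def)
qed

lemma polar_polar:
  assumes P_body: "closed P" "convex P" "0 \<in> P"
  shows "polar (polar P) = P"
proof (intro equalityI subsetI)
  fix z assume z_bipolar: "z \<in> polar (polar P)"
  show "z \<in> P"
  proof (rule ccontr)
    assume "z \<notin> P"
    then obtain a b where separation: "a \<bullet> z < b" "\<And>x. x \<in> P \<Longrightarrow> a \<bullet> x > b"
      using separating_hyperplane_closed_point[OF P_body(2,1)] by metis
    have b_neg: "b < 0" using separation(2)[OF P_body(3)] by simp
    have "(1 / b) *\<^sub>R a \<in> polar P"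
      unfolding polar_def using b_neg less_imp_le[OF separation(2)] by (auto simp: divide_le_eq)
    then have "z \<bullet> ((1 / b) *\<^sub>R a) \<le> 1" using z_bipolar unfolding polar_def[of "polar P"] by blast
    then have "a \<bullet> z \<ge> b" using b_neg by (simp add: divide_le_eq inner_commute)
    then show False using separation(1) by simp
  qed
qed (auto simp: polar_def inner_commute)

lemma polar_Un: "polar (K \<union> L) = polar K \<inter> polar L"
  by (auto simp: polar_def)

lemma polar_Int:
  assumes "closed K" "closed L" "convex (K \<union> L)"
  shows "polar (K \<inter> L) = polar K \<union> polar L"
proof (intro equalityI subsetI)
  fix y assume y_polar: "y \<in> polar (K \<inter> L)"
  show "y \<in> polar K \<union> polar L"
  proof (rule ccontr)
    assume "y \<notin> polar K \<union> polar L"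
    then obtain u v where u_violates: "u \<in> K" "y \<bullet> u > 1" and v_violates: "v \<in> L" "y \<bullet> v > 1"
      by (auto simp: polar_def not_le)
    have "closed_segment u v \<subseteq> K \<union> L"
      using u_violates v_violates assms(3) by (intro closed_segment_subset) auto
    moreover have "connected (closed_segment u v)" by simp
    ultimately have "K \<inter> L \<inter> closed_segment u v \<noteq> {}"
      using u_violates v_violates assms(1,2) connected_closedD[of "closed_segment u v" K L]
      by fastforce
    then obtain z where z_common: "z \<in> K \<inter> L" "z \<in> closed_segment u v" by blast
    have "closed_segment u v \<subseteq> {x. y \<bullet> x > 1}"
      using u_violates v_violates by (intro closed_segment_subset convex_halfspace_gt) auto
    then show False using z_common y_polar by (force simp: polar_def)
  qed
qed (auto simp: polar_def)

lemma polar_linear_image: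
  assumes inverse: "transpose A ** M = mat 1"
  shows "polar ((*v) A ` P) = (*v) M ` polar P"
proof -
  have "M ** transpose A = mat 1" using inverse by (simp add: matrix_left_right_inverse)
  then have inv: "M *v (transpose A *v y) = y" "transpose A *v (M *v y) = y" for y
    using inverse by (simp_all add: matrix_vector_mul_assoc del: transpose_matrix_vector)
  have "y \<in> polar ((*v) A ` P) \<longleftrightarrow> transpose A *v y \<in> polar P" for y
    by (simp add: polar_def dot_lmul_matrix)
  then show ?thesis using inv by (metis (no_types, lifting) imageE image_eqI subsetI subset_antisym)
qed

lemma rot90_inverse_transpose:
  assumes inverse: "transpose A ** M = mat 1"
  shows "rot90 (M *v x) = det M *\<^sub>R (A *v rot90 x)"
proof -
  have "transpose M ** A = mat 1"
    using arg_cong[OF inverse, of transpose] by (simp add: matrix_transpose_mul transpose_mat)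
  then have "A ** transpose M = mat 1" by (simp add: matrix_left_right_inverse)
  then have "rot90 (M *v x) = A *v (transpose M *v rot90 (M *v x))"
    by (simp add: matrix_vector_mul_assoc del: transpose_matrix_vector)
  then show ?thesis by (simp add: rot90_mult_matrix matrix_vector_mult_scaleR)
qed

section \<open>Measurability along a family of quadrilaterals\<close>

definition dilation_close :: "real \<Rightarrow> 'a::real_vector set \<Rightarrow> 'a set \<Rightarrow> bool" where
  "dilation_close n K L \<longleftrightarrow> K \<subseteq> (*\<^sub>R) (1 + n) ` L \<and> L \<subseteq> (*\<^sub>R) (1 + n) ` K"

lemma hausdorff_dist_le_dilation:
  assumes "dilation_close n K L" "n \<ge> 0" "K \<noteq> {}" "L \<noteq> {}" "K \<subseteq> cball 0 R" "L \<subseteq> cball 0 R"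
  shows "hausdorff_dist K L \<le> n * R"
proof -
  have "(SUP x\<in>K. setdist {x} L) \<le> n * R"
    if "K \<noteq> {}" and dilation: "K \<subseteq> (*\<^sub>R) (1 + n) ` L" and "L \<subseteq> cball 0 R" for K L :: "R2 set"
  proof (rule cSUP_least)
    fix x assume "x \<in> K"
    then obtain z where x_eq: "z \<in> L" "x = (1 + n) *\<^sub>R z" using dilation by blast
    have "setdist {x} L \<le> dist x z" using x_eq by (intro setdist_le_dist) auto
    also have "\<dots> = n * norm z" using x_eq \<open>n \<ge> 0\<close> by (simp add: dist_norm algebra_simps)
    also have "\<dots> \<le> n * R" using x_eq \<open>L \<subseteq> cball 0 R\<close> \<open>n \<ge> 0\<close> by (intro mult_left_mono) auto
    finally show "setdist {x} L \<le> n * R" .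
  qed fact
  then show ?thesis using assms unfolding hausdorff_dist_def dilation_close_def by auto
qed

lemma eventually_hausdorff_dist_less:
  assumes K_bounded: "bounded K" "K \<noteq> {}" and nonempty: "\<And>x. f x \<noteq> {}" and "e > 0"
    and close: "\<And>n. n > 0 \<Longrightarrow> \<forall>\<^sub>F x in F. dilation_close n K (f x)"
  shows "\<forall>\<^sub>F x in F. hausdorff_dist K (f x) < e"
proof -
  obtain R where "R > 0" and K_ball: "K \<subseteq> cball 0 R"
    using K_bounded(1) by (auto simp: bounded_pos subset_iff)
  define n where "n = min 1 (e / (4 * R))"
  have n_range: "n > 0" "n \<le> 1" using \<open>e > 0\<close> \<open>R > 0\<close> by (auto simp: n_def)
  have "n * (2 * R) \<le> e / (4 * R) * (2 * R)"
    using \<open>R > 0\<close> by (intro mult_right_mono) (auto simp: n_def)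
  also have "\<dots> < e" using \<open>e > 0\<close> \<open>R > 0\<close> by simp
  finally have small: "n * (2 * R) < e" .
  from close[OF n_range(1)] show ?thesis
  proof eventually_elim
    case (elim x)
    have "f x \<subseteq> cball 0 (2 * R)"
    proof
      fix y assume "y \<in> f x"
      then obtain z where "z \<in> cball 0 R" "y = (1 + n) *\<^sub>R z"
        using elim K_ball unfolding dilation_close_def by blast
      then show "y \<in> cball 0 (2 * R)" using n_range \<open>R > 0\<close> by (auto intro!: mult_mono)
    qed
    moreover have "K \<subseteq> cball 0 (2 * R)" using K_ball \<open>R > 0\<close> by force
    ultimately have "hausdorff_dist K (f x) \<le> n * (2 * R)"
      using elim n_range K_bounded(2) nonempty by (intro hausdorff_dist_le_dilation) auto
    then show ?case using small by simp
  qed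
qed

lemma measurable_polygons_borelI:
  fixes f :: "'a::topological_space \<Rightarrow> R2 set"
  assumes f_polygon: "\<And>c. f c \<in> polygons_o"
    and close: "\<And>c n. n > 0 \<Longrightarrow> \<forall>\<^sub>F c' in nhds c. dilation_close n (f c) (f c')"
  shows "f \<in> measurable borel polygons_borel"
  unfolding polygons_borel_def
proof (rule measurable_measure_of)
  show "{U. hausdorff_open U} \<subseteq> Pow polygons_o" by (auto simp: hausdorff_open_def)
  show "f \<in> space borel \<rightarrow> polygons_o" using f_polygon by simp
  fix U assume "U \<in> {U. hausdorff_open U}"
  then have U_open: "hausdorff_open U" by simp
  have nonempty: "f c \<noteq> {}" for c using polygons_oD(4)[OF f_polygon] by blast
  have "\<exists>T. open T \<and> c \<in> T \<and> T \<subseteq> f -` U" if "c \<in> f -` U" for c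
  proof -
    have "f c \<in> U" using that by simp
    then obtain e where "e > 0" and ball: "\<And>Q. Q \<in> polygons_o \<Longrightarrow> hausdorff_dist (f c) Q < e \<Longrightarrow> Q \<in> U"
      using U_open unfolding hausdorff_open_def by blast
    have "\<forall>\<^sub>F c' in nhds c. hausdorff_dist (f c) (f c') < e"
      by (intro eventually_hausdorff_dist_less compact_imp_bounded polygons_oD(1)[OF f_polygon]
          nonempty close \<open>e > 0\<close>)
    then have "\<forall>\<^sub>F c' in nhds c. f c' \<in> U"
      by eventually_elim (rule ball[OF f_polygon])
    then show ?thesis unfolding eventually_nhds by blast
  qed
  then have "open (f -` U)" by (subst open_subopen) blast
  then show "f -` U \<inter> space borel \<in> sets borel" by simp
qed

lemma polar_dilation_subset:
  assumes "P \<subseteq> (*\<^sub>R) (1 + n) ` Q" "n \<ge> 0"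
  shows "polar Q \<subseteq> (*\<^sub>R) (1 + n) ` polar P"
proof
  fix y assume y_polar: "y \<in> polar Q"
  have "(1 / (1 + n)) *\<^sub>R y \<in> polar P"
    unfolding polar_def using assms y_polar by (force simp: polar_def)
  moreover have "y = (1 + n) *\<^sub>R ((1 / (1 + n)) *\<^sub>R y)" using assms(2) by simp
  ultimately show "y \<in> (*\<^sub>R) (1 + n) ` polar P" by blast
qed

lemma dilation_close_polar:
  "dilation_close n P Q \<Longrightarrow> n \<ge> 0 \<Longrightarrow> dilation_close n (polar P) (polar Q)"
  unfolding dilation_close_def using polar_dilation_subset by blast

lemma add_scaleR_in_dilation:
  fixes Q :: "'a::real_vector set"
  assumes "convex Q" "x \<in> Q" "h \<in> Q" "n \<ge> 0"
  shows "x + n *\<^sub>R h \<in> (*\<^sub>R) (1 + n) ` Q"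
proof (rule image_eqI)
  show "(1 / (1 + n)) *\<^sub>R x + (n / (1 + n)) *\<^sub>R h \<in> Q"
    using assms by (intro convexD) (auto simp: add_divide_distrib[symmetric])
  show "x + n *\<^sub>R h = (1 + n) *\<^sub>R ((1 / (1 + n)) *\<^sub>R x + (n / (1 + n)) *\<^sub>R h)"
    using assms(4) by (simp add: scaleR_add_right)
qed

lemma quad_dilation_subset:
  assumes pos: "a > 0" "b > 0" "t > 0" "s > 0" and n_bound: "n > 0" "\<bar>c - c'\<bar> * t \<le> n * min a b"
  shows "quad a b c t d s \<subseteq> (*\<^sub>R) (1 + n) ` quad a b c' t d s"
proof -
  let ?Q = "quad a b c' t d s"
  have convex: "convex ?Q" by (simp add: quad_def)
  have vertices: "pt b 0 \<in> ?Q" "pt (- a) 0 \<in> ?Q" "pt (c' * t) t \<in> ?Q" "pt (d * s) (- s) \<in> ?Q"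
    by (auto simp: quad_def hull_inc)
  have "0 \<in> ?Q" using polygons_oD(4)[OF quad_in_polygons_o[OF pos]] .
  then have self: "x \<in> (*\<^sub>R) (1 + n) ` ?Q" if "x \<in> ?Q" for x
    using add_scaleR_in_dilation[OF convex that, of 0 n] n_bound(1) by simp
  define h where "h = (c - c') * t / n"
  have "\<bar>h\<bar> = \<bar>c - c'\<bar> * t / n" using n_bound(1) pos by (simp add: h_def abs_mult)
  also have "\<dots> \<le> min a b" using n_bound by (simp only: pos_divide_le_eq mult.commute)
  finally have "pt h 0 \<in> closed_segment (pt (- a) 0) (pt b 0)"
    by (intro pt_0_in_closed_segment) auto
  then have "pt h 0 \<in> ?Q"
    using closed_segment_subset[OF vertices(2,1) convex] by blast
  then have "pt (c' * t) t + n *\<^sub>R pt h 0 \<in> (*\<^sub>R) (1 + n) ` ?Q"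
    using n_bound(1) by (intro add_scaleR_in_dilation[OF convex vertices(3)]) auto
  moreover have "n * h = (c - c') * t" using n_bound(1) by (simp add: h_def)
  then have "pt (c' * t) t + n *\<^sub>R pt h 0 = pt (c * t) t"
    by (simp add: R2_eq_iff left_diff_distrib)
  ultimately show ?thesis
    unfolding quad_def[of a b c] using self vertices convex
    by (intro hull_minimal convex_scaling) auto
qed

lemma eventually_dilation_close_quad:
  assumes pos: "a > 0" "b > 0" "t > 0" "s > 0" and "n > 0"
  shows "\<forall>\<^sub>F c' in nhds c. dilation_close n (quad a b c t d s) (quad a b c' t d s)"
proof -
  define e where "e = n * min a b / t"
  have "e > 0" using \<open>n > 0\<close> pos by (simp add: e_def)
  then have "\<forall>\<^sub>F c' in nhds c. dist c' c < e" by (metis eventually_nhds_metric)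
  then show ?thesis
  proof eventually_elim
    case (elim c')
    then have "\<bar>c - c'\<bar> * t \<le> n * min a b"
      using pos by (simp add: dist_real_def abs_minus_commute e_def pos_less_divide_eq)
    then show ?case
      unfolding dilation_close_def using \<open>n > 0\<close> pos
      by (intro conjI quad_dilation_subset) (simp_all add: abs_minus_commute)
  qed
qed

lemma measurable_polar_quad:
  assumes "a > 0" "b > 0" "t > 0" "s > 0"
  shows "(\<lambda>c. polar (quad a b c t d s)) \<in> measurable borel polygons_borel"
proof (rule measurable_polygons_borelI)
  show "polar (quad a b c t d s) \<in> polygons_o" for c
    by (intro polar_in_polygons_o quad_in_polygons_o assms)
  fix c n :: real assume "n > 0"
  from eventually_dilation_close_quad[OF assms this, of c d]
  show "\<forall>\<^sub>F c' in nhds c. dilation_close n (polar (quad a b c t d s)) (polar (quad a b c' t d s))"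
    by eventually_elim (use \<open>n > 0\<close> in \<open>simp add: dilation_close_polar\<close>)
qed

section \<open>Signum-covariant valuations\<close>

lemma covariant_valuation_polar:
  assumes val: "is_valuation_on polygons_o mu"
    and cov: "\<And>A P. A \<in> VL2 \<Longrightarrow> P \<in> polygons_o \<Longrightarrow> mu ((*v) A ` P) = det A *\<^sub>R (A *v mu P)"
  shows "covariant_valuation (\<lambda>P. - rot90 (mu (polar P)))"
proof
  have "mu (polar (K \<union> L)) + mu (polar (K \<inter> L)) = mu (polar K) + mu (polar L)"
    if polygons: "K \<in> polygons_o" "L \<in> polygons_o" "K \<union> L \<in> polygons_o" "K \<inter> L \<in> polygons_o" for K L
  proof -
    have Int: "polar (K \<inter> L) = polar K \<union> polar L"
      using polygons by (intro polar_Int compact_imp_closed polygons_oD)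
    have "mu (polar K \<union> polar L) + mu (polar K \<inter> polar L) = mu (polar K) + mu (polar L)"
      using val polygons[THEN polar_in_polygons_o] unfolding is_valuation_on_def polar_Un Int
      by blast
    then show ?thesis by (simp add: polar_Un Int add.commute)
  qed
  then show "is_valuation_on polygons_o (\<lambda>P. - rot90 (mu (polar P)))"
    unfolding is_valuation_on_def
    by (metis linear_add[OF linear_rot90] minus_add_distrib)
next
  fix A :: "real^2^2" and P :: "R2 set"
  assume A_VL2: "A \<in> VL2" and polygon: "P \<in> polygons_o"
  obtain M where inverse: "transpose A ** M = mat 1"
    using VL2_invertible[OF A_VL2] transpose_invertible invertible_right_inverse by blast
  have "det A * det M = 1" using arg_cong[OF inverse, of det] by (simp add: det_mul)
  then have det: "det M * det M = 1" and "M \<in> VL2" using A_VL2 by (auto simp: VL2_def)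
  then have "mu (polar ((*v) A ` P)) = det M *\<^sub>R (M *v mu (polar P))"
    using cov polar_in_polygons_o[OF polygon] by (simp add: polar_linear_image[OF inverse])
  then show "- rot90 (mu (polar ((*v) A ` P))) = A *v (- rot90 (mu (polar P)))"
    using det by (simp add: linear_scale[OF linear_rot90] rot90_inverse_transpose[OF inverse]
        linear_neg[OF matrix_vector_mul_linear])
qed

lemma regular_covariant_valuation_polar:
  assumes meas: "mu \<in> measurable polygons_borel borel"
    and cov: "covariant_valuation (\<lambda>P. - rot90 (mu (polar P)))"
  shows "regular_covariant_valuation (\<lambda>P. - rot90 (mu (polar P)))"
  unfolding regular_covariant_valuation_def regular_covariant_valuation_axioms_def
proof (intro conjI allI impI cov)
  fix a b t s :: real assume pos: "a > 0" "b > 0" "t > 0" "s > 0"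
  have "(\<lambda>c. mu (polar (quad a b c t 0 s))) \<in> borel_measurable borel"
    using measurable_compose[OF measurable_polar_quad[OF pos] meas] .
  moreover have "(\<lambda>x. - rot90 x) \<in> borel_measurable borel"
    using linear_continuous_on[OF linear_rot90[unfolded linear_conv_bounded_linear]]
    by (intro borel_measurable_continuous_onI continuous_on_minus)
  ultimately have "(\<lambda>c. - rot90 (mu (polar (quad a b c t 0 s)))) \<in> borel_measurable borel"
    by (rule measurable_compose)
  moreover have "\<not> negligible {-1..1::real}" by (simp add: negligible_iff_measure)
  ultimately show "bounded_on_nonnegligible {-1..1} (\<lambda>c. - rot90 (mu (polar (quad a b c t 0 s))))"
    by (intro borel_measurable_imp_bounded_on_nonnegligible) auto
qed

theorem theorem3p9:
  fixes mu :: "R2 set \<Rightarrow> R2"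
  assumes meas: "mu \<in> measurable polygons_borel borel"
    and val: "is_valuation_on polygons_o mu"
    and cov: "\<And>A P. A \<in> VL2 \<Longrightarrow> P \<in> polygons_o \<Longrightarrow>
                 mu ((\<lambda>x. A *v x) ` P) = det A *\<^sub>R (A *v mu P)"
  shows "\<exists>k::real. \<forall>P\<in>polygons_o. mu P = k *\<^sub>R rot90 (moment (polar P))"
proof -
  define nu where "nu P = - rot90 (mu (polar P))" for P
  have "regular_covariant_valuation nu"
    unfolding nu_def
    by (intro regular_covariant_valuation_polar covariant_valuation_polar meas val cov)
  then obtain k where nu_eq: "\<And>P. P \<in> polygons_o \<Longrightarrow> nu P = k *\<^sub>R moment P"
    using regular_covariant_valuation_eq_moment by blast
  have "mu P = k *\<^sub>R rot90 (moment (polar P))" if polygon: "P \<in> polygons_o" for P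
  proof -
    have "mu P = rot90 (nu (polar P))"
      using polygons_oD[OF polygon] by (simp add: nu_def polar_polar compact_imp_closed R2_eq_iff)
    also have "\<dots> = k *\<^sub>R rot90 (moment (polar P))"
      by (simp add: nu_eq[OF polar_in_polygons_o[OF polygon]] linear_scale[OF linear_rot90])
    finally show ?thesis .
  qed
  then show ?thesis by blast
qed

end
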